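(* (a) Let $\tau\in S\subseteq S_n$. Then $\tau(\Lambda_m(I_j(S)))=\Lambda_m(I_j(S))$ for any $j$ with $1\le j\le t(S)$ and any $m\le |I_j(S)|$. (b) For any subset $S\subseteq S_n$, the intersection $\bigcap_{\tau\in S}Q_{n,\tau}$ is generated, as an algebra, by $\{\Lambda_m(I_j(S))\mid 1\le j\le t(S),\ 1\le m\le |I_j(S)|\}$.
   Context: Let $k$ be a field and $n\ge 1$. $Q_n$ is the associative unital $k$-algebra with generators $z_{A,i}$, for $A\subseteq\{1,\dots,n\}$ and $i\in\{1,\dots,n\}\setminus A$, and defining relations $$z_{A\cup\{i\},j}+z_{A,i}=z_{A\cup\{j\},i}+z_{A,j},\qquad z_{A\cup\{i\},j}\,z_{A,i}=z_{A\cup\{j\},i}\,z_{A,j}$$ for all $A$ and all distinct $i,j\notin A$. Subalgebras are unital $k$-subalgebras. The symmetric group $S_n$ acts on $Q_n$ by algebra automorphisms with $\sigma(z_{A,i})=z_{\sigma(A),\sigma(i)}$. For $A=\{c_1,\dots,c_u\}$ put $r(A)=z_{\emptyset,c_1}+z_{\{c_1\},c_2}+\dots+z_{\{c_1,\dots,c_{u-1}\},c_u}$, which does not depend on the ordering of $A$. For $\tau\in S_n$, $Q_{n,\tau}$ is the subalgebra of $Q_n$ generated by $r(\{\tau(1),\dots,\tau(m)\})$, $m=1,\dots,n$. For a subset $S\subseteq S_n$, let $I_1(S),\dots,I_{t(S)}(S)$ be the unique finest partition of $\{1,\dots,n\}$ into $S$-invariant intervals (sets of consecutive integers, with $\tau(I_j(S))=I_j(S)$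 for all $\tau\in S$), numbered in increasing order; thus each $I_j(S)$ is a minimal $S$-invariant interval. Put $y_i=z_{\{1,\dots,i-1\},i}$ for $1\le i\le n$. For an interval $I\subseteq\{1,\dots,n\}$ put $\Lambda_0(I)=1$ and, for $m\ge1$, $$\Lambda_m(I)=\sum_{i_1>i_2>\dots>i_m,\ i_1,\dots,i_m\in I}y_{i_1}y_{i_2}\cdots y_{i_m}.$$
   Formalization: Part (b) is stated only for subsets S containing the identity; for arbitrary S it is false, e.g. n=2, S={(1 2)}: the intersection contains z_{∅,2}, which is not in the algebra generated by y_1+y_2 and y_2y_1. *)

theory Defs
  imports
    "HOL-Algebra.QuotRing"
    "HOL-Algebra.Embedded_Algebras"
    "HOL-Library.Poly_Mapping"
    "HOL-Library.Disjoint_Sets"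
    "HOL-Combinatorics.Permutations"
begin

section \<open>The free algebra\<close>

datatype 'g fmon = FMon (letters: "'g list")

text \<open>
  \<^typ>\<open>'g fmon\<close> is the free monoid on \<^typ>\<open>'g\<close>, written additively so that the convolution product of
  \<^theory>\<open>HOL-Library.Poly_Mapping\<close> makes \<open>'g fmon \<Rightarrow>\<^sub>0 'k\<close> the free associative unital algebra on \<^typ>\<open>'g\<close>.
\<close>

instantiation fmon :: (type) monoid_add
begin

definition zero_fmon :: "'a fmon" where
  "0 = FMon []"

definition plus_fmon :: "'a fmon \<Rightarrow> 'a fmon \<Rightarrow> 'a fmon" where
  "v + w = FMon (letters v @ letters w)"

instance
  by standard (simp_all add: zero_fmon_def plus_fmon_def)

end

text \<open>The pair \<open>(A, i)\<close> names the generator \<open>z\<^bsub>A,i\<^esub>\<close>.\<close>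

type_synonym zgen = "nat set \<times> nat"
type_synonym 'k freealg = "zgen fmon \<Rightarrow>\<^sub>0 'k"

definition zgens :: "nat \<Rightarrow> zgen set" where
  "zgens n = {(A, i). A \<subseteq> {1..n} \<and> i \<in> {1..n} - A}"

definition free_alg :: "nat \<Rightarrow> 'k::field freealg ring" where
  "free_alg n =
    \<lparr>carrier = {p. \<forall>w\<in>Poly_Mapping.keys p. set (letters w) \<subseteq> zgens n},
     monoid.mult = (*), one = 1, zero = 0, add = (+)\<rparr>"

definition free_gen :: "nat set \<Rightarrow> nat \<Rightarrow> 'k::field freealg" where
  "free_gen A i = Poly_Mapping.single (FMon [(A, i)]) 1"

definition relators :: "nat \<Rightarrow> 'k::field freealg set" where
  "relators n =
    {(free_gen (A \<union> {i}) j + free_gen A i) - (free_gen (A \<union> {j}) i + free_gen A j) | A i j.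
       A \<subseteq> {1..n} \<and> i \<in> {1..n} - A \<and> j \<in> {1..n} - A \<and> i \<noteq> j} \<union>
    {free_gen (A \<union> {i}) j * free_gen A i - free_gen (A \<union> {j}) i * free_gen A j | A i j.
       A \<subseteq> {1..n} \<and> i \<in> {1..n} - A \<and> j \<in> {1..n} - A \<and> i \<noteq> j}"


section \<open>The algebra \<open>Q\<^sub>n\<close>\<close>

text \<open>In HOL-Algebra ideals are two-sided.\<close>

definition Qideal :: "nat \<Rightarrow> 'k::field freealg set" where
  "Qideal n = Idl\<^bsub>free_alg n\<^esub> (relators n)"

definition Qalg :: "nat \<Rightarrow> 'k::field freealg set ring" where
  "Qalg n = free_alg n Quot Qideal n"

definition Qproj :: "nat \<Rightarrow> 'k::field freealg \<Rightarrow> 'k freealg set" where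
  "Qproj n p = Qideal n +>\<^bsub>free_alg n\<^esub> p"

definition zel :: "nat \<Rightarrow> nat set \<Rightarrow> nat \<Rightarrow> 'k::field freealg set" where
  "zel n A i = Qproj n (free_gen A i)"

definition Qscalar :: "nat \<Rightarrow> 'k::field \<Rightarrow> 'k freealg set" where
  "Qscalar n c = Qproj n (Poly_Mapping.single 0 c)"

text \<open>
  The library's \<^const>\<open>subalgebra\<close> only asks for an additive subgroup closed under scalars;
  \<^const>\<open>subring\<close> adds the unit and closure under products.
\<close>

definition Qsubalgebra :: "nat \<Rightarrow> 'k::field freealg set set \<Rightarrow> bool" where
  "Qsubalgebra n B \<longleftrightarrow> subring B (Qalg n) \<and> subalgebra (range (Qscalar n)) B (Qalg n)"

definition Qgenerated :: "nat \<Rightarrow> 'k::field freealg set set \<Rightarrow> 'k freealg set set" where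
  "Qgenerated n X = Qsubalgebra n hull X"


section \<open>The action of the symmetric group\<close>

definition free_act :: "(nat \<Rightarrow> nat) \<Rightarrow> 'k::field freealg \<Rightarrow> 'k freealg" where
  "free_act \<sigma> p =
    (\<Sum>w\<in>Poly_Mapping.keys p.
       Poly_Mapping.single (map_fmon (\<lambda>(A, i). (\<sigma> ` A, \<sigma> i)) w) (Poly_Mapping.lookup p w))"

text \<open>
  For a permutation \<open>\<sigma>\<close> of \<open>{1..n}\<close> the automorphism \<^term>\<open>free_act \<sigma>\<close> of the free algebra preserves
  \<^term>\<open>Qideal n\<close>, so the induced automorphism of the quotient sends a coset to its image;
  see \<open>Qact_ring_iso\<close>, \<open>Qact_Qscalar\<close> and \<open>Qact_zel\<close> below.
\<close>

definition Qact :: "(nat \<Rightarrow> nat) \<Rightarrow> 'k::field freealg set \<Rightarrow> 'k freealg set" where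
  "Qact \<sigma> X = free_act \<sigma> ` X"


section \<open>The elements \<open>r(A)\<close> and the subalgebras \<open>Q\<^bsub>n,\<tau>\<^esub>\<close>\<close>

definition r_list :: "nat \<Rightarrow> nat list \<Rightarrow> 'k::field freealg set" where
  "r_list n cs = (\<Oplus>\<^bsub>Qalg n\<^esub>k\<in>{..<length cs}. zel n (set (take k cs)) (cs ! k))"

text \<open>By \<open>r_list_eq_r\<close> below, every other ordering of \<open>A\<close> gives the same element.\<close>

definition r :: "nat \<Rightarrow> nat set \<Rightarrow> 'k::field freealg set" where
  "r n A = r_list n (sorted_list_of_set A)"

definition Qsub :: "nat \<Rightarrow> (nat \<Rightarrow> nat) \<Rightarrow> 'k::field freealg set set" where
  "Qsub n \<tau> = Qgenerated n {r n (\<tau> ` {1..m}) | m. m \<in> {1..n}}"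


section \<open>The invariant interval partition\<close>

definition invariant_interval :: "(nat \<Rightarrow> nat) set \<Rightarrow> nat set \<Rightarrow> bool" where
  "invariant_interval S I \<longleftrightarrow> (\<exists>a b. I = {a..b}) \<and> (\<forall>\<tau>\<in>S. \<tau> ` I = I)"

definition invariant_interval_partition :: "nat \<Rightarrow> (nat \<Rightarrow> nat) set \<Rightarrow> nat set set \<Rightarrow> bool" where
  "invariant_interval_partition n S P \<longleftrightarrow>
    partition_on {1..n} P \<and> (\<forall>I\<in>P. invariant_interval S I)"

text \<open>Existence and uniqueness of the finest such partition is \<open>ex1_finest_partition\<close> below.\<close>

definition blocks :: "nat \<Rightarrow> (nat \<Rightarrow> nat) set \<Rightarrow> nat set set" where
  "blocks n S =
    (THE P. invariant_interval_partition n S P \<and>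
       (\<forall>P'. invariant_interval_partition n S P' \<longrightarrow> refines {1..n} P P'))"

definition num_blocks :: "nat \<Rightarrow> (nat \<Rightarrow> nat) set \<Rightarrow> nat" where
  "num_blocks n S = card (blocks n S)"

text \<open>The blocks are numbered from 1 in increasing order.\<close>

definition block :: "nat \<Rightarrow> (nat \<Rightarrow> nat) set \<Rightarrow> nat \<Rightarrow> nat set" where
  "block n S j = sorted_key_list_of_set Min (blocks n S) ! (j - 1)"


section \<open>The elements \<open>\<Lambda>\<^sub>m(I)\<close>\<close>

definition yel :: "nat \<Rightarrow> nat \<Rightarrow> 'k::field freealg set" where
  "yel n i = zel n {1..<i} i"

text \<open>For \<open>m = 0\<close> the only index list is the empty one, so the value is the unit.\<close>

definition Lambda :: "nat \<Rightarrow> nat \<Rightarrow> nat set \<Rightarrow> 'k::field freealg set" where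
  "Lambda n m I =
    (\<Oplus>\<^bsub>Qalg n\<^esub>xs\<in>{xs. length xs = m \<and> sorted_wrt (>) xs \<and> set xs \<subseteq> I}.
       foldr (\<otimes>\<^bsub>Qalg n\<^esub>) (map (yel n) xs) \<one>\<^bsub>Qalg n\<^esub>)"

section \<open>Well-definedness\<close>

lemma free_alg_simps [simp]:
  "monoid.mult (free_alg n) = (*)" "one (free_alg n) = 1" "zero (free_alg n) = 0" "add (free_alg n) = (+)"
  by (simp_all add: free_alg_def)

lemma in_free_alg_iff:
  "p \<in> carrier (free_alg n) \<longleftrightarrow> (\<forall>w\<in>Poly_Mapping.keys p. set (letters w) \<subseteq> zgens n)"
  by (simp add: free_alg_def)

lemma keys_uminus: "Poly_Mapping.keys (- p :: 'b \<Rightarrow>\<^sub>0 'c::ab_group_add) = Poly_Mapping.keys p"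
  by transfer simp

lemma free_alg_closed:
  fixes p q :: "'k::field freealg"
  assumes "p \<in> carrier (free_alg n)" "q \<in> carrier (free_alg n)"
  shows "p + q \<in> carrier (free_alg n)" "p * q \<in> carrier (free_alg n)"
    "- p \<in> carrier (free_alg n)" "p - q \<in> carrier (free_alg n)"
proof -
  have add: "a + b \<in> carrier (free_alg n)"
    if "a \<in> carrier (free_alg n)" "b \<in> carrier (free_alg n)" for a b :: "'k freealg"
    using that Poly_Mapping.keys_add[of a b] unfolding in_free_alg_iff by blast
  have neg: "- a \<in> carrier (free_alg n)" if "a \<in> carrier (free_alg n)" for a :: "'k freealg"
    using that unfolding in_free_alg_iff keys_uminus .
  show "p + q \<in> carrier (free_alg n)" "- p \<in> carrier (free_alg n)"
    using assms add neg by blast+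
  show "p - q \<in> carrier (free_alg n)"
    using add[OF assms(1) neg[OF assms(2)]] by simp
  show "p * q \<in> carrier (free_alg n)"
    unfolding in_free_alg_iff
  proof
    fix w assume "w \<in> Poly_Mapping.keys (p * q)"
    then obtain u v where "w = u + v" "u \<in> Poly_Mapping.keys p" "v \<in> Poly_Mapping.keys q"
      using keys_mult[of p q] by blast
    then show "set (letters w) \<subseteq> zgens n"
      using assms unfolding in_free_alg_iff by (auto simp: plus_fmon_def)
  qed
qed

lemma single_in_free_alg:
  "set (letters w) \<subseteq> zgens n \<Longrightarrow> Poly_Mapping.single w c \<in> carrier (free_alg n)"
  by (auto simp: in_free_alg_iff)

lemma scalar_in_free_alg: "Poly_Mapping.single 0 c \<in> carrier (free_alg n)"
  by (rule single_in_free_alg) (simp add: zero_fmon_def)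

lemma free_gen_in_free_alg: "(A, i) \<in> zgens n \<Longrightarrow> free_gen A i \<in> carrier (free_alg n)"
  unfolding free_gen_def by (rule single_in_free_alg) simp

lemma one_in_free_alg: "1 \<in> carrier (free_alg n :: 'k::field freealg ring)"
  using scalar_in_free_alg[of 1 n] by simp

lemma ring_free_alg: "ring (free_alg n :: 'k::field freealg ring)"
proof (rule ringI)
  show "abelian_group (free_alg n :: 'k freealg ring)"
  proof (rule abelian_groupI)
    fix x :: "'k freealg" assume "x \<in> carrier (free_alg n)"
    then show "\<exists>y\<in>carrier (free_alg n). y \<oplus>\<^bsub>free_alg n\<^esub> x = \<zero>\<^bsub>free_alg n\<^esub>"
      by (intro bexI[of _ "- x"]) (simp_all add: free_alg_closed)
  qed (simp_all add: free_alg_closed add_ac, simp add: in_free_alg_iff)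
  show "Group.monoid (free_alg n :: 'k freealg ring)"
    by (rule monoidI) (simp_all add: free_alg_closed mult.assoc one_in_free_alg)
qed (simp_all add: distrib_left distrib_right)

lemma relators_subset: "relators n \<subseteq> carrier (free_alg n :: 'k::field freealg ring)"
  unfolding relators_def
  by (auto intro!: free_alg_closed free_gen_in_free_alg simp: zgens_def)

lemma ideal_Qideal: "ideal (Qideal n) (free_alg n :: 'k::field freealg ring)"
  unfolding Qideal_def by (rule ring.genideal_ideal[OF ring_free_alg relators_subset])

lemma relators_subset_Qideal: "relators n \<subseteq> (Qideal n :: 'k::field freealg set)"
  unfolding Qideal_def by (rule ring.genideal_self[OF ring_free_alg relators_subset])

lemma ring_Qalg: "ring (Qalg n :: 'k::field freealg set ring)"
  unfolding Qalg_def by (rule ideal.quotient_is_ring[OF ideal_Qideal])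

lemma Qproj_hom: "ring_hom_ring (free_alg n) (Qalg n) (Qproj n :: 'k::field freealg \<Rightarrow> _)"
proof -
  have "Qproj n = (+>\<^bsub>free_alg n\<^esub>) (Qideal n :: 'k freealg set)"
    by (simp add: Qproj_def fun_eq_iff)
  then show ?thesis
    unfolding Qalg_def by (simp add: ideal.rcos_ring_hom_ring[OF ideal_Qideal])
qed

lemma carrier_Qalg: "carrier (Qalg n :: 'k::field freealg set ring) = Qproj n ` carrier (free_alg n)"
  by (auto simp: Qalg_def FactRing_def A_RCOSETS_defs a_r_coset_def r_coset_def Qproj_def)

lemma Qproj_eq_iff:
  fixes p q :: "'k::field freealg"
  assumes p: "p \<in> carrier (free_alg n)" and q: "q \<in> carrier (free_alg n)"
  shows "Qproj n p = Qproj n q \<longleftrightarrow> p - q \<in> Qideal n"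
proof -
  interpret I: ideal "Qideal n" "free_alg n :: 'k freealg ring" by (rule ideal_Qideal)
  have minus: "x \<ominus>\<^bsub>free_alg n\<^esub> y = x - y"
    if "x \<in> carrier (free_alg n)" "y \<in> carrier (free_alg n)" for x y :: "'k freealg"
  proof -
    have "\<ominus>\<^bsub>free_alg n\<^esub> y = - y"
      using I.minus_equality[of "- y" y] that by (simp add: free_alg_closed)
    then show ?thesis by (simp add: a_minus_def)
  qed
  show ?thesis
    unfolding Qproj_def using I.quotient_eq_iff_same_a_r_cos[OF ideal_Qideal p q] minus[OF p q] by simp
qed

lemma zel_closed: "(A, i) \<in> zgens n \<Longrightarrow> zel n A i \<in> carrier (Qalg n)"
  unfolding zel_def carrier_Qalg by (intro imageI free_gen_in_free_alg)

lemma zel_relations: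
  assumes "A \<subseteq> {1..n}" "i \<in> {1..n} - A" "j \<in> {1..n} - A" "i \<noteq> j"
  shows "zel n (A \<union> {i}) j \<oplus>\<^bsub>Qalg n\<^esub> zel n A i =
      (zel n (A \<union> {j}) i \<oplus>\<^bsub>Qalg n\<^esub> zel n A j :: 'k::field freealg set)" (is ?sum)
    and "zel n (A \<union> {i}) j \<otimes>\<^bsub>Qalg n\<^esub> zel n A i =
      (zel n (A \<union> {j}) i \<otimes>\<^bsub>Qalg n\<^esub> zel n A j :: 'k freealg set)" (is ?prod)
proof -
  interpret h: ring_hom_ring "free_alg n" "Qalg n" "Qproj n :: 'k freealg \<Rightarrow> _" by (rule Qproj_hom)
  have g: "free_gen (A \<union> {i}) j \<in> carrier (free_alg n :: 'k freealg ring)"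
    "free_gen A i \<in> carrier (free_alg n :: 'k freealg ring)"
    "free_gen (A \<union> {j}) i \<in> carrier (free_alg n :: 'k freealg ring)"
    "free_gen A j \<in> carrier (free_alg n :: 'k freealg ring)"
    by (rule free_gen_in_free_alg; use assms in \<open>simp add: zgens_def\<close>)+
  have "(free_gen (A \<union> {i}) j + free_gen A i) - (free_gen (A \<union> {j}) i + free_gen A j)
      \<in> (relators n :: 'k freealg set)"
    unfolding relators_def using assms by blast
  then have "Qproj n (free_gen (A \<union> {i}) j + free_gen A i :: 'k freealg) =
      Qproj n (free_gen (A \<union> {j}) i + free_gen A j)"
    using relators_subset_Qideal by (subst Qproj_eq_iff) (blast intro: free_alg_closed g)+
  then show ?sum
    using h.hom_add[OF g(1,2)] h.hom_add[OF g(3,4)] by (simp add: zel_def)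
  have "free_gen (A \<union> {i}) j * free_gen A i - free_gen (A \<union> {j}) i * free_gen A j
      \<in> (relators n :: 'k freealg set)"
    unfolding relators_def using assms by blast
  then have "Qproj n (free_gen (A \<union> {i}) j * free_gen A i :: 'k freealg) =
      Qproj n (free_gen (A \<union> {j}) i * free_gen A j)"
    using relators_subset_Qideal by (subst Qproj_eq_iff) (blast intro: free_alg_closed g)+
  then show ?prod
    using h.hom_mult[OF g(1,2)] h.hom_mult[OF g(3,4)] by (simp add: zel_def)
qed

lemma zgens_nth:
  assumes "distinct cs" "set cs \<subseteq> {1..n}" "k < length cs"
  shows "(set (take k cs), cs ! k) \<in> zgens n"
proof -
  have "set (take k cs) \<subseteq> {1..n}" "cs ! k \<in> {1..n}"
    using assms set_take_subset[of k cs] nth_mem[of k cs] by blast+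
  moreover have "cs ! k \<notin> set (take k cs)"
    using assms by (auto simp: in_set_conv_nth nth_eq_iff_index_eq)
  ultimately show ?thesis by (simp add: zgens_def)
qed

lemma r_list_closed:
  assumes "distinct cs" "set cs \<subseteq> {1..n}"
  shows "r_list n cs \<in> carrier (Qalg n :: 'k::field freealg set ring)"
proof -
  interpret Q: ring "Qalg n :: 'k freealg set ring" by (rule ring_Qalg)
  have "(set (take k cs), cs ! k) \<in> zgens n" if "k < length cs" for k
    using zgens_nth assms that by blast
  then show ?thesis
    unfolding r_list_def by (intro Q.finsum_closed) (auto intro!: zel_closed)
qed

lemma r_list_snoc:
  assumes "distinct (cs @ [c])" "set (cs @ [c]) \<subseteq> {1..n}"
  shows "r_list n (cs @ [c]) =
    (zel n (set cs) c \<oplus>\<^bsub>Qalg n\<^esub> r_list n cs :: 'k::field freealg set)"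
proof -
  interpret Q: ring "Qalg n :: 'k freealg set ring" by (rule ring_Qalg)
  have z: "(set (take k cs), cs ! k) \<in> zgens n" if "k < length cs" for k
    using zgens_nth assms that by simp
  have zc: "(set cs, c) \<in> zgens n"
    using assms by (auto simp: zgens_def)
  have "r_list n (cs @ [c]) = (\<Oplus>\<^bsub>Qalg n\<^esub>k\<in>insert (length cs) {..<length cs}.
      zel n (set (take k (cs @ [c]))) ((cs @ [c]) ! k) :: 'k freealg set)"
    by (simp add: r_list_def lessThan_Suc)
  also have "\<dots> = zel n (set cs) c \<oplus>\<^bsub>Qalg n\<^esub>
      (\<Oplus>\<^bsub>Qalg n\<^esub>k\<in>{..<length cs}. zel n (set (take k (cs @ [c]))) ((cs @ [c]) ! k))"
    by (subst Q.finsum_insert) (auto intro!: zel_closed z zc simp: nth_append)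
  also have "(\<Oplus>\<^bsub>Qalg n\<^esub>k\<in>{..<length cs}. zel n (set (take k (cs @ [c]))) ((cs @ [c]) ! k)) =
      (r_list n cs :: 'k freealg set)"
    unfolding r_list_def
    by (rule Q.finsum_cong') (auto intro!: zel_closed z simp: nth_append)
  finally show ?thesis .
qed

lemma r_list_cong:
  assumes "distinct xs" "distinct ys" "set xs = set ys" "set xs \<subseteq> {1..n}"
  shows "r_list n xs = (r_list n ys :: 'k::field freealg set)"
  using assms
proof (induction "length xs" arbitrary: xs ys rule: less_induct)
  case less
  interpret Q: ring "Qalg n :: 'k freealg set ring" by (rule ring_Qalg)
  show ?case
  proof (cases xs rule: rev_cases)
    case Nil
    then show ?thesis using less.prems by simp
  next
    case xs: (snoc xs' a)
    obtain ys' b where ys: "ys = ys' @ [b]"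
      using less.prems(3) xs by (cases ys rule: rev_cases) auto
    have fin: "finite (set xs)" by simp
    show ?thesis
    proof (cases "a = b")
      case True
      have "set xs' = set ys'"
        using less.prems xs ys True by auto
      then have "r_list n xs' = (r_list n ys' :: 'k freealg set)"
        using less.prems xs ys by (intro less.hyps) auto
      then show ?thesis
        using less.prems xs ys True \<open>set xs' = set ys'\<close>
        by (simp add: r_list_snoc)
    next
      case False
      define A where "A = set xs - {a, b}"
      obtain zs where zs: "set zs = A" "distinct zs"
        using finite_distinct_list[of A] unfolding A_def by auto
      have A: "A \<subseteq> {1..n}" "a \<in> {1..n} - A" "b \<in> {1..n} - A"
        using less.prems xs ys unfolding A_def by auto
      have sets: "set xs' = A \<union> {b}" "set ys' = A \<union> {a}"
        using less.prems xs ys False unfolding A_def by auto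
      have "length ys = length xs"
        using less.prems distinct_card[of xs] distinct_card[of ys] by simp
      then have len: "length xs' < length xs" "length ys' < length xs"
        using xs ys by auto
      have zA: "(A, a) \<in> zgens n" "(A, b) \<in> zgens n" "(A \<union> {b}, a) \<in> zgens n" "(A \<union> {a}, b) \<in> zgens n"
        using A False by (auto simp: zgens_def)
      have "r_list n xs' = (r_list n (zs @ [b]) :: 'k freealg set)"
        using less.prems xs zs sets A len by (intro less.hyps) auto
      moreover have "r_list n ys' = (r_list n (zs @ [a]) :: 'k freealg set)"
        using less.prems ys zs sets A len by (intro less.hyps) auto
      ultimately have "r_list n xs =
          (zel n (A \<union> {b}) a \<oplus>\<^bsub>Qalg n\<^esub> (zel n A b \<oplus>\<^bsub>Qalg n\<^esub> r_list n zs) :: 'k freealg set)"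
        "r_list n ys =
          (zel n (A \<union> {a}) b \<oplus>\<^bsub>Qalg n\<^esub> (zel n A a \<oplus>\<^bsub>Qalg n\<^esub> r_list n zs) :: 'k freealg set)"
        using less.prems A zs sets unfolding xs ys by (simp_all add: r_list_snoc)
      moreover have "r_list n zs \<in> carrier (Qalg n :: 'k freealg set ring)"
        using zs A by (intro r_list_closed) auto
      ultimately show ?thesis
        using zel_relations(1)[of A n b a, where 'k = 'k] A False
        by (simp add: Q.a_assoc[symmetric] zel_closed zA del: Un_insert_right)
    qed
  qed
qed

lemma r_list_eq_r:
  assumes "distinct cs" "set cs \<subseteq> {1..n}"
  shows "r_list n cs = r n (set cs)"
  unfolding r_def using assms by (intro r_list_cong) auto

lemma free_act_superset:
  assumes "finite K" "Poly_Mapping.keys p \<subseteq> K"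
  shows "free_act \<sigma> p =
    (\<Sum>w\<in>K. Poly_Mapping.single (map_fmon (\<lambda>(A, i). (\<sigma> ` A, \<sigma> i)) w) (Poly_Mapping.lookup p w))"
  unfolding free_act_def
  by (rule sum.mono_neutral_left) (use assms in \<open>auto simp: in_keys_iff\<close>)

lemma free_act_single:
  "free_act \<sigma> (Poly_Mapping.single w c) =
    Poly_Mapping.single (map_fmon (\<lambda>(A, i). (\<sigma> ` A, \<sigma> i)) w) c"
  by (subst free_act_superset[of "{w}"]) auto

lemma free_act_zero [simp]: "free_act \<sigma> 0 = 0"
  by (simp add: free_act_def)

lemma free_act_add: "free_act \<sigma> (p + q) = free_act \<sigma> p + free_act \<sigma> q"
proof -
  let ?K = "Poly_Mapping.keys p \<union> Poly_Mapping.keys q"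
  have "finite ?K" "Poly_Mapping.keys (p + q) \<subseteq> ?K"
    using Poly_Mapping.keys_add[of p q] by auto
  then show ?thesis
    by (simp add: free_act_superset[of ?K] lookup_add single_add sum.distrib)
qed

lemma free_act_sum: "free_act \<sigma> (sum f X) = (\<Sum>x\<in>X. free_act \<sigma> (f x))"
  by (induction X rule: infinite_finite_induct) (simp_all add: free_act_add)

lemma free_act_diff: "free_act \<sigma> (p - q) = free_act \<sigma> p - free_act \<sigma> q"
  using free_act_add[of \<sigma> "p - q" q] by simp

lemma sum_single_lookup:
  "(\<Sum>w\<in>Poly_Mapping.keys p. Poly_Mapping.single w (Poly_Mapping.lookup p w)) = p"
proof (rule poly_mapping_eqI)
  fix v
  have "Poly_Mapping.lookup
      (\<Sum>w\<in>Poly_Mapping.keys p. Poly_Mapping.single w (Poly_Mapping.lookup p w)) v =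
      (\<Sum>w\<in>Poly_Mapping.keys p. if w = v then Poly_Mapping.lookup p w else 0)"
    by (simp add: lookup_sum lookup_single when_def)
  then show "Poly_Mapping.lookup
      (\<Sum>w\<in>Poly_Mapping.keys p. Poly_Mapping.single w (Poly_Mapping.lookup p w)) v =
      Poly_Mapping.lookup p v"
    by (simp add: in_keys_iff)
qed

lemma map_fmon_plus: "map_fmon f (v + w) = map_fmon f v + map_fmon f w"
  by (cases v; cases w) (simp add: plus_fmon_def)

lemma map_fmon_zero: "map_fmon f 0 = 0"
  by (simp add: zero_fmon_def)

lemma free_act_mult: "free_act \<sigma> (p * q) = free_act \<sigma> p * free_act \<sigma> q"
proof -
  define s where "s = (\<lambda>p w. Poly_Mapping.single w (Poly_Mapping.lookup p w) :: 'a freealg)"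
  have "free_act \<sigma> ((\<Sum>v\<in>Poly_Mapping.keys p. s p v) * (\<Sum>w\<in>Poly_Mapping.keys q. s q w)) =
      free_act \<sigma> (\<Sum>v\<in>Poly_Mapping.keys p. s p v) * free_act \<sigma> (\<Sum>w\<in>Poly_Mapping.keys q. s q w)"
    by (simp add: sum_product free_act_sum s_def mult_single free_act_single map_fmon_plus)
  then show ?thesis
    unfolding s_def by (simp only: sum_single_lookup)
qed

lemma free_act_gen: "free_act \<sigma> (free_gen A i) = free_gen (\<sigma> ` A) (\<sigma> i)"
  by (simp add: free_gen_def free_act_single)

lemma zgens_act:
  assumes "\<sigma> permutes {1..n}" "(A, i) \<in> zgens n"
  shows "(\<sigma> ` A, \<sigma> i) \<in> zgens n"
proof -
  have "\<sigma> ` A \<subseteq> {1..n}" "\<sigma> i \<in> {1..n}"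
    using assms permutes_image[OF assms(1)] by (auto simp: zgens_def)
  moreover have "\<sigma> i \<notin> \<sigma> ` A"
    using assms permutes_inj[OF assms(1)] by (auto simp: zgens_def inj_image_mem_iff)
  ultimately show ?thesis by (simp add: zgens_def)
qed

lemma free_act_closed:
  fixes p :: "'k::field freealg"
  assumes "\<sigma> permutes {1..n}" "p \<in> carrier (free_alg n)"
  shows "free_act \<sigma> p \<in> carrier (free_alg n)"
  unfolding in_free_alg_iff
proof
  let ?f = "map_fmon (\<lambda>(A, i). (\<sigma> ` A, \<sigma> i))"
  fix w assume "w \<in> Poly_Mapping.keys (free_act \<sigma> p)"
  moreover have "Poly_Mapping.keys (free_act \<sigma> p) \<subseteq> ?f ` Poly_Mapping.keys p"
    unfolding free_act_def by (rule order_trans[OF keys_sum]) auto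
  ultimately obtain v where v: "v \<in> Poly_Mapping.keys p" "w = ?f v"
    by blast
  have "set (letters v) \<subseteq> zgens n"
    using assms(2) v(1) by (simp add: in_free_alg_iff)
  then show "set (letters w) \<subseteq> zgens n"
    using zgens_act[OF assms(1)] v(2) by (cases v) auto
qed

lemma free_act_hom:
  assumes "\<sigma> permutes {1..n}"
  shows "ring_hom_ring (free_alg n) (free_alg n) (free_act \<sigma> :: 'k::field freealg \<Rightarrow> _)"
proof (rule ring_hom_ringI[OF ring_free_alg ring_free_alg])
  have "free_act \<sigma> (1 :: 'k freealg) = 1"
    using free_act_single[of \<sigma> 0 "1 :: 'k"] by (simp add: map_fmon_zero)
  then show "free_act \<sigma> \<one>\<^bsub>free_alg n\<^esub> = (\<one>\<^bsub>free_alg n\<^esub> :: 'k freealg)" by simp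
qed (simp_all add: free_act_closed[OF assms] free_act_mult free_act_add)

lemma free_act_inverse:
  assumes "\<And>i. \<rho> (\<sigma> i) = i"
  shows "free_act \<rho> (free_act \<sigma> p) = p"
proof -
  have id: "(\<lambda>(A, i). (\<rho> ` A, \<rho> i)) \<circ> (\<lambda>(A, i). (\<sigma> ` A, \<sigma> i)) = id"
    by (auto simp: fun_eq_iff image_image assms)
  have "free_act \<rho> (free_act \<sigma> p) =
      (\<Sum>w\<in>Poly_Mapping.keys p. Poly_Mapping.single w (Poly_Mapping.lookup p w))"
    by (simp add: free_act_def[of \<sigma>] free_act_sum free_act_single fmon.map_comp id fmon.map_id)
  then show ?thesis by (simp only: sum_single_lookup)
qed

lemma free_act_Qideal_subset:
  assumes \<sigma>: "\<sigma> permutes {1..n}"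
  shows "free_act \<sigma> ` Qideal n \<subseteq> (Qideal n :: 'k::field freealg set)"
proof -
  interpret h: ring_hom_ring "free_alg n" "free_alg n" "free_act \<sigma> :: 'k freealg \<Rightarrow> _"
    by (rule free_act_hom[OF \<sigma>])
  let ?V = "{p \<in> carrier (free_alg n). free_act \<sigma> p \<in> (Qideal n :: 'k freealg set)}"
  have "free_act \<sigma> p \<in> relators n" if "p \<in> relators n" for p :: "'k freealg"
  proof -
    from that obtain A i j where A: "A \<subseteq> {1..n}" "i \<in> {1..n} - A" "j \<in> {1..n} - A" "i \<noteq> j"
      and p: "p = (free_gen (A \<union> {i}) j + free_gen A i) - (free_gen (A \<union> {j}) i + free_gen A j) \<or>
        p = free_gen (A \<union> {i}) j * free_gen A i - free_gen (A \<union> {j}) i * free_gen A j"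
      unfolding relators_def by blast
    have "(\<sigma> ` A, \<sigma> i) \<in> zgens n" "(\<sigma> ` A, \<sigma> j) \<in> zgens n"
      by (rule zgens_act[OF \<sigma>]; use A in \<open>simp add: zgens_def\<close>)+
    then have A': "\<sigma> ` A \<subseteq> {1..n}" "\<sigma> i \<in> {1..n} - \<sigma> ` A" "\<sigma> j \<in> {1..n} - \<sigma> ` A"
      by (simp_all add: zgens_def)
    have "\<sigma> i \<noteq> \<sigma> j"
      using A(4) permutes_inj[OF \<sigma>] by (simp add: inj_eq)
    have im: "\<sigma> ` (A \<union> {x}) = \<sigma> ` A \<union> {\<sigma> x}" for x by auto
    from p have "free_act \<sigma> p =
          (free_gen (\<sigma> ` A \<union> {\<sigma> i}) (\<sigma> j) + free_gen (\<sigma> ` A) (\<sigma> i)) -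
          (free_gen (\<sigma> ` A \<union> {\<sigma> j}) (\<sigma> i) + free_gen (\<sigma> ` A) (\<sigma> j)) \<or>
        free_act \<sigma> p =
          free_gen (\<sigma> ` A \<union> {\<sigma> i}) (\<sigma> j) * free_gen (\<sigma> ` A) (\<sigma> i) -
          free_gen (\<sigma> ` A \<union> {\<sigma> j}) (\<sigma> i) * free_gen (\<sigma> ` A) (\<sigma> j)"
      by (auto simp only: free_act_diff free_act_add free_act_mult free_act_gen im)
    then show ?thesis
      unfolding relators_def using A' \<open>\<sigma> i \<noteq> \<sigma> j\<close> by blast
  qed
  then have "relators n \<subseteq> ?V"
    using relators_subset relators_subset_Qideal by blast
  moreover have "ideal ?V (free_alg n)"
    by (rule h.ideal_vimage[OF ideal_Qideal])
  ultimately have "Qideal n \<subseteq> ?V"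
    unfolding Qideal_def by (intro ring.genideal_minimal[OF ring_free_alg])
  then show ?thesis by blast
qed

lemma free_act_Qideal:
  assumes \<sigma>: "\<sigma> permutes {1..n}"
  shows "free_act \<sigma> ` Qideal n = (Qideal n :: 'k::field freealg set)"
proof
  show "Qideal n \<subseteq> free_act \<sigma> ` (Qideal n :: 'k freealg set)"
  proof
    fix p :: "'k freealg" assume "p \<in> Qideal n"
    then have "free_act (Hilbert_Choice.inv \<sigma>) p \<in> Qideal n"
      using free_act_Qideal_subset[OF permutes_inv[OF \<sigma>]] by blast
    moreover have "free_act \<sigma> (free_act (Hilbert_Choice.inv \<sigma>) p) = p"
      by (rule free_act_inverse) (rule permutes_inverses(1)[OF \<sigma>])
    ultimately show "p \<in> free_act \<sigma> ` Qideal n"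
      by (metis imageI)
  qed
qed (rule free_act_Qideal_subset[OF \<sigma>])

lemma Qact_Qproj:
  assumes "\<sigma> permutes {1..n}"
  shows "Qact \<sigma> (Qproj n p) = (Qproj n (free_act \<sigma> p) :: 'k::field freealg set)"
proof -
  have coset: "Qproj n q = (\<lambda>h. h + q) ` Qideal n" for q :: "'k freealg"
    by (auto simp: Qproj_def a_r_coset_def r_coset_def)
  have "Qact \<sigma> (Qproj n p) = (\<lambda>h. h + free_act \<sigma> p) ` free_act \<sigma> ` Qideal n"
    by (simp add: Qact_def coset image_image free_act_add)
  then show ?thesis
    by (simp only: free_act_Qideal[OF assms] coset)
qed

lemma Qact_zel:
  assumes "\<sigma> permutes {1..n}"
  shows "Qact \<sigma> (zel n A i) = (zel n (\<sigma> ` A) (\<sigma> i) :: 'k::field freealg set)"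
  by (simp add: zel_def Qact_Qproj[OF assms] free_act_gen)

lemma Qact_Qscalar:
  assumes "\<sigma> permutes {1..n}"
  shows "Qact \<sigma> (Qscalar n c) = (Qscalar n c :: 'k::field freealg set)"
  by (simp add: Qscalar_def Qact_Qproj[OF assms] free_act_single map_fmon_zero)

lemma Qact_ring_iso:
  assumes \<sigma>: "\<sigma> permutes {1..n}"
  shows "Qact \<sigma> \<in> ring_iso (Qalg n) (Qalg n :: 'k::field freealg set ring)"
proof -
  interpret h: ring_hom_ring "free_alg n" "Qalg n" "Qproj n :: 'k freealg \<Rightarrow> _" by (rule Qproj_hom)
  interpret g: ring_hom_ring "free_alg n" "free_alg n" "free_act \<sigma> :: 'k freealg \<Rightarrow> _"
    by (rule free_act_hom[OF \<sigma>])
  have "Qact \<sigma> \<in> ring_hom (Qalg n) (Qalg n :: 'k freealg set ring)"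
  proof (rule ring_hom_memI)
    fix x y :: "'k freealg set"
    assume "x \<in> carrier (Qalg n)" "y \<in> carrier (Qalg n)"
    then obtain p q where pq: "p \<in> carrier (free_alg n)" "q \<in> carrier (free_alg n)"
      "x = Qproj n p" "y = Qproj n q"
      by (auto simp: carrier_Qalg)
    show "Qact \<sigma> (x \<otimes>\<^bsub>Qalg n\<^esub> y) = Qact \<sigma> x \<otimes>\<^bsub>Qalg n\<^esub> Qact \<sigma> y"
      using pq by (simp add: Qact_Qproj[OF \<sigma>] g.hom_closed
          h.hom_mult[symmetric, unfolded free_alg_simps] free_act_mult)
    show "Qact \<sigma> (x \<oplus>\<^bsub>Qalg n\<^esub> y) = Qact \<sigma> x \<oplus>\<^bsub>Qalg n\<^esub> Qact \<sigma> y"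
      using pq by (simp add: Qact_Qproj[OF \<sigma>] g.hom_closed
          h.hom_add[symmetric, unfolded free_alg_simps] free_act_add)
  next
    fix x :: "'k freealg set" assume "x \<in> carrier (Qalg n)"
    then show "Qact \<sigma> x \<in> carrier (Qalg n)"
      by (auto simp: carrier_Qalg Qact_Qproj[OF \<sigma>] g.hom_closed)
  next
    show "Qact \<sigma> \<one>\<^bsub>Qalg n\<^esub> = (\<one>\<^bsub>Qalg n\<^esub> :: 'k freealg set)"
      using h.hom_one g.hom_one by (metis Qact_Qproj[OF \<sigma>])
  qed
  moreover have "bij_betw (Qact \<sigma>) (carrier (Qalg n)) (carrier (Qalg n :: 'k freealg set ring))"
  proof (rule bij_betw_byWitness[where f' = "Qact (Hilbert_Choice.inv \<sigma>)"])
    note inv = permutes_inv[OF \<sigma>]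
    show "\<forall>x\<in>carrier (Qalg n). Qact (Hilbert_Choice.inv \<sigma>) (Qact \<sigma> x) = (x :: 'k freealg set)"
      by (auto simp: carrier_Qalg Qact_Qproj[OF \<sigma>] Qact_Qproj[OF inv]
          free_act_inverse permutes_inverses[OF \<sigma>])
    show "\<forall>x\<in>carrier (Qalg n). Qact \<sigma> (Qact (Hilbert_Choice.inv \<sigma>) x) = (x :: 'k freealg set)"
      by (auto simp: carrier_Qalg Qact_Qproj[OF \<sigma>] Qact_Qproj[OF inv]
          free_act_inverse permutes_inverses[OF \<sigma>])
    show "Qact \<sigma> ` carrier (Qalg n) \<subseteq> (carrier (Qalg n) :: 'k freealg set set)"
      by (auto simp: carrier_Qalg Qact_Qproj[OF \<sigma>] free_act_closed[OF \<sigma>])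
    show "Qact (Hilbert_Choice.inv \<sigma>) ` carrier (Qalg n) \<subseteq> (carrier (Qalg n) :: 'k freealg set set)"
      by (auto simp: carrier_Qalg Qact_Qproj[OF inv] free_act_closed[OF inv])
  qed
  ultimately show ?thesis by (simp add: ring_iso_def)
qed

lemma ex1_finest_partition:
  assumes n: "n \<ge> 1" and S: "S \<subseteq> {\<sigma>. \<sigma> permutes {1..n}}"
  shows "\<exists>!P. invariant_interval_partition n S P \<and>
    (\<forall>P'. invariant_interval_partition n S P' \<longrightarrow> refines {1..n} P P')"
proof -
  define \<P> where "\<P> = {P. invariant_interval_partition n S P}"
  have part: "partition_on {1..n} P" if "P \<in> \<P>" for P
    using that by (simp add: \<P>_def invariant_interval_partition_def)
  have "\<tau> ` {1..n} = {1..n}" if "\<tau> \<in> S" for \<tau>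
    using S that permutes_image by blast
  then have "invariant_interval S {1..n}"
    unfolding invariant_interval_def by blast
  then have "invariant_interval_partition n S {{1..n}}"
    using n by (simp add: invariant_interval_partition_def partition_on_def)
  then have ne: "\<P> \<noteq> {}" by (auto simp: \<P>_def)
  have "invariant_interval S X" if "X \<in> common_refinement \<P>" for X
  proof -
    from that obtain f where f: "f \<in> (\<Pi> P\<in>\<P>. P)" and X: "X = \<Inter> (f ` \<P>)" "X \<noteq> {}"
      by (auto simp: common_refinement)
    have fP: "invariant_interval S (f P)" if "P \<in> \<P>" for P
      using f that by (auto simp: \<P>_def invariant_interval_partition_def)
    have "X \<subseteq> {1..n}"
      using partition_on_common_refinement[OF part ne] that
      by (auto simp: partition_on_def)
    then have fin: "finite X" by (rule finite_subset) simp
    have "{Min X..Max X} \<subseteq> X"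
    proof
      fix x assume x: "x \<in> {Min X..Max X}"
      show "x \<in> X" unfolding X
      proof (rule INT_I)
        fix P assume P: "P \<in> \<P>"
        then obtain a b where ab: "f P = {a..b}"
          using fP[OF P] by (auto simp: invariant_interval_def)
        have "Min X \<in> f P" "Max X \<in> f P"
          using Min_in[OF fin X(2)] Max_in[OF fin X(2)] P X(1) by blast+
        then show "x \<in> f P" using x ab by auto
      qed
    qed
    then have "X = {Min X..Max X}" using fin by auto
    moreover have "\<tau> ` X = X" if "\<tau> \<in> S" for \<tau>
    proof -
      have "inj \<tau>" using S that permutes_inj by blast
      moreover obtain P where "P \<in> \<P>" using ne by blast
      ultimately have "\<tau> ` X = (\<Inter>P\<in>\<P>. \<tau> ` f P)"
        unfolding X by (intro image_INT[where C = UNIV]) auto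
      also have "\<dots> = X"
        unfolding X using fP that by (auto simp: invariant_interval_def)
      finally show ?thesis .
    qed
    ultimately show ?thesis unfolding invariant_interval_def by blast
  qed
  then have "invariant_interval_partition n S (common_refinement \<P>)"
    using partition_on_common_refinement[OF part ne] by (simp add: invariant_interval_partition_def)
  moreover have "refines {1..n} (common_refinement \<P>) P" if "invariant_interval_partition n S P" for P
    using that by (intro refines_common_refinement[OF part]) (simp_all add: \<P>_def)
  ultimately show ?thesis
    by (metis refines_asym)
qed

end

theory Submission
  imports Defs
begin

text \<open>
  Part (a). Read a path \<open>B \<subset> B \<union> {c\<^sub>1} \<subset> B \<union> {c\<^sub>1, c\<^sub>2} \<subset> \<dots>\<close> of sets as a noncommutative
  factorization, the step from \<open>A\<close> to \<open>A \<union> {i}\<close> contributing the root \<open>z\<^bsub>A,i\<^esub>\<close>. The two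
  defining relations of \<open>Q\<^sub>n\<close> say that exchanging two consecutive steps changes neither the sum nor
  the product of the two roots, so the elementary symmetric functions of the roots along a path depend
  only on its two ends (\<open>path_sym_independent\<close>). For a block \<open>I = {a..<k}\<close> the elements
  \<open>\<Lambda>\<^sub>m(I)\<close> are these functions for the increasing path from \<open>{1..<a}\<close> to \<open>{1..<k}\<close>. Every
  \<open>\<tau> \<in> S\<close> preserves both ends, hence fixes \<open>\<Lambda>\<^sub>m(I)\<close>; and since the image path is part of the
  flag \<open>\<tau>{1} \<subset> \<tau>{1, 2} \<subset> \<dots>\<close>, the element \<open>\<Lambda>\<^sub>m(I)\<close> lies in \<open>Q\<^bsub>n,\<tau>\<^esub>\<close>. This also gives
  one inclusion of part (b).

  For the other inclusion, let \<open>f\<close> lie in the intersection. As the identity belongs to \<open>S\<close>, \<open>f\<close>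
  is the value of a noncommutative polynomial \<open>F\<close> at \<open>y\<^sub>1, \<dots>, y\<^sub>n\<close>. Let \<open>i\<close> and
  \<open>i + 1\<close> be in the same block. Then some \<open>\<tau> \<in> S\<close> does not preserve \<open>X = {1..i}\<close>, so the flag of
  \<open>\<tau>\<close> misses \<open>X\<close>. There are two homomorphisms from \<open>Q\<^sub>n\<close> to a free algebra which differ only on
  the roots of the steps into and out of \<open>X\<close>: the first sends \<open>z\<^bsub>A,j\<^esub>\<close> to an element depending
  only on the cardinality of \<open>A\<close> (the relations then hold trivially), the second changes the images
  of the two kinds of steps at \<open>X\<close> while keeping their sum and product. With free letters \<open>p, q\<close>,
  such a change is possible because

    \<open>p(q + 1) + qp = pq + (q + 1)p\<close>  and  \<open>p(q + 1) \<cdot> qp = pq \<cdot> (q + 1)p\<close>.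

  The two homomorphisms agree on \<open>Q\<^bsub>n,\<tau>\<^esub>\<close>, hence on \<open>f\<close>; comparing coefficients shows that
  the coefficient of a word in \<open>F\<close> does not change when a letter \<open>i\<close> is replaced by \<open>i + 1\<close>,
  provided that this creates and destroys no descent (\<open>twist_eq_if_missed\<close>,
  \<open>lookup_eq_if_fsubst_twist_eq\<close>).

  It remains to identify the polynomials invariant under all these moves. The moves connect any two
  words with the same sequence of blocks and the same descents inside blocks
  (\<open>move_invariant_canon\<close>), so \<open>F\<close> is a linear combination of the sums of all words with
  prescribed blocks and descents. These are analogues of ribbon Schur functions and, by the usual
  multiplication rule \<open>ribbon_Cons\<close>, polynomials in the elementary functions of the blocks.
\<close>

section \<open>Substitution homomorphisms of free algebras\<close>

definition word :: "'g list \<Rightarrow> 'g fmon \<Rightarrow>\<^sub>0 'k::field" where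
  "word w = Poly_Mapping.single (FMon w) 1"

definition fsubst :: "('g \<Rightarrow> 'h fmon \<Rightarrow>\<^sub>0 'k::field) \<Rightarrow> ('g fmon \<Rightarrow>\<^sub>0 'k) \<Rightarrow> ('h fmon \<Rightarrow>\<^sub>0 'k)" where
  "fsubst g P = (\<Sum>w\<in>Poly_Mapping.keys P.
     Poly_Mapping.single 0 (Poly_Mapping.lookup P w) * prod_list (map g (letters w)))"

lemma word_Nil: "word [] = 1"
  by (simp add: word_def zero_fmon_def[symmetric])

lemma word_append: "word (v @ w) = (word v * word w :: 'g fmon \<Rightarrow>\<^sub>0 'k::field)"
  by (simp add: word_def mult_single plus_fmon_def)

lemma letters_plus: "letters (v + w) = letters v @ letters w"
  by (simp add: plus_fmon_def)

lemma scalar_commute: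
  "Poly_Mapping.single 0 c * p = p * (Poly_Mapping.single 0 c :: 'g fmon \<Rightarrow>\<^sub>0 'k::field)"
proof -
  have "Poly_Mapping.single 0 c * (\<Sum>w\<in>Poly_Mapping.keys p. Poly_Mapping.single w (Poly_Mapping.lookup p w)) =
    (\<Sum>w\<in>Poly_Mapping.keys p. Poly_Mapping.single w (Poly_Mapping.lookup p w)) * Poly_Mapping.single 0 c"
    by (simp add: sum_distrib_left sum_distrib_right mult_single mult.commute)
  then show ?thesis by (simp add: sum_single_lookup)
qed

lemma lookup_scalar_mult:
  "Poly_Mapping.lookup (Poly_Mapping.single 0 c * p) w = c * Poly_Mapping.lookup (p :: 'g fmon \<Rightarrow>\<^sub>0 'k::field) w"
proof -
  have "Poly_Mapping.lookup (Poly_Mapping.single 0 c * (\<Sum>w\<in>Poly_Mapping.keys p. Poly_Mapping.single w (Poly_Mapping.lookup p w))) w =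
    c * Poly_Mapping.lookup (\<Sum>w\<in>Poly_Mapping.keys p. Poly_Mapping.single w (Poly_Mapping.lookup p w)) w"
    by (simp add: sum_distrib_left mult_single lookup_sum lookup_single when_def if_distrib cong: if_cong)
  then show ?thesis by (simp add: sum_single_lookup)
qed

lemma lookup_word_mult:
  "Poly_Mapping.lookup (word t * p) (FMon s) =
    (if take (length t) s = t then Poly_Mapping.lookup p (FMon (drop (length t) s)) else (0::'k::field))"
proof -
  have eq: "t @ letters w = s \<longleftrightarrow> take (length t) s = t \<and> w = FMon (drop (length t) s)" for w
    by (cases w) (metis append_eq_conv_conj fmon.sel fmon.inject)
  have "Poly_Mapping.lookup (word t * (\<Sum>w\<in>Poly_Mapping.keys p. Poly_Mapping.single w (Poly_Mapping.lookup p w))) (FMon s) =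
    (if take (length t) s = t then Poly_Mapping.lookup (\<Sum>w\<in>Poly_Mapping.keys p. Poly_Mapping.single w (Poly_Mapping.lookup p w)) (FMon (drop (length t) s)) else (0::'k))"
    by (auto simp: sum_distrib_left word_def mult_single plus_fmon_def lookup_sum lookup_single when_def eq intro!: sum.cong)
  then show ?thesis by (simp add: sum_single_lookup)
qed

lemma fsubst_superset:
  assumes "finite K" "Poly_Mapping.keys P \<subseteq> K"
  shows "fsubst g P = (\<Sum>w\<in>K.
     Poly_Mapping.single 0 (Poly_Mapping.lookup P w) * prod_list (map g (letters w)))"
  unfolding fsubst_def by (rule sum.mono_neutral_left) (use assms in \<open>auto simp: in_keys_iff\<close>)

lemma fsubst_single:
  "fsubst g (Poly_Mapping.single w c) = Poly_Mapping.single 0 c * prod_list (map g (letters w))"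
  by (subst fsubst_superset[of "{w}"]) auto

lemma fsubst_word: "fsubst g (word w) = prod_list (map g w)"
  by (simp add: word_def fsubst_single)

lemma fsubst_scalar: "fsubst g (Poly_Mapping.single 0 c) = Poly_Mapping.single 0 c"
  by (simp add: fsubst_single zero_fmon_def)

lemma fsubst_zero [simp]: "fsubst g 0 = 0"
  by (simp add: fsubst_def)

lemma fsubst_one [simp]: "fsubst g 1 = 1"
  using fsubst_scalar[of g 1] by simp

lemma fsubst_add: "fsubst g (P + R) = fsubst g P + fsubst g R"
proof -
  let ?K = "Poly_Mapping.keys P \<union> Poly_Mapping.keys R"
  have "finite ?K" "Poly_Mapping.keys (P + R) \<subseteq> ?K"
    using Poly_Mapping.keys_add[of P R] by auto
  then show ?thesis
    by (simp add: fsubst_superset[of ?K] lookup_add single_add sum.distrib distrib_right)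
qed

lemma fsubst_diff: "fsubst g (P - R) = fsubst g P - fsubst g R"
  using fsubst_add[of g "P - R" R] by simp

lemma fsubst_uminus: "fsubst g (- P) = - fsubst g P"
  using fsubst_diff[of g 0 P] by simp

lemma fsubst_sum: "fsubst g (sum f X) = (\<Sum>x\<in>X. fsubst g (f x))"
  by (induction X rule: infinite_finite_induct) (simp_all add: fsubst_add)

lemma fsubst_mult:
  fixes P R :: "'g fmon \<Rightarrow>\<^sub>0 'k::field"
  shows "fsubst g (P * R) = fsubst g P * fsubst g R"
proof -
  define s where "s = (\<lambda>P w. Poly_Mapping.single w (Poly_Mapping.lookup P w) :: 'g fmon \<Rightarrow>\<^sub>0 'k)"
  have single: "fsubst g (s P v * s R w) = fsubst g (s P v) * fsubst g (s R w)" for v w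
  proof -
    have "fsubst g (s P v * s R w) = Poly_Mapping.single 0 (Poly_Mapping.lookup P v) *
        (Poly_Mapping.single 0 (Poly_Mapping.lookup R w) * prod_list (map g (letters v))) * prod_list (map g (letters w))"
      by (simp add: s_def mult_single fsubst_single letters_plus mult.assoc flip: mult.assoc[of "Poly_Mapping.single 0 _" "Poly_Mapping.single 0 _"])
    also have "\<dots> = Poly_Mapping.single 0 (Poly_Mapping.lookup P v) *
        (prod_list (map g (letters v)) * Poly_Mapping.single 0 (Poly_Mapping.lookup R w)) * prod_list (map g (letters w))"
      by (simp only: scalar_commute)
    finally show ?thesis by (simp add: s_def fsubst_single mult.assoc)
  qed
  have "fsubst g ((\<Sum>v\<in>Poly_Mapping.keys P. s P v) * (\<Sum>w\<in>Poly_Mapping.keys R. s R w)) =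
      fsubst g (\<Sum>v\<in>Poly_Mapping.keys P. s P v) * fsubst g (\<Sum>w\<in>Poly_Mapping.keys R. s R w)"
    by (simp add: sum_product fsubst_sum single)
  then show ?thesis
    unfolding s_def by (simp only: sum_single_lookup)
qed

lemma fsubst_prod_list: "fsubst g (prod_list Ps) = prod_list (map (fsubst g) Ps)"
  by (induction Ps) (simp_all add: fsubst_mult)

lemma fsubst_fsubst: "fsubst g (fsubst h P) = fsubst (\<lambda>x. fsubst g (h x)) P"
  unfolding fsubst_def[of h P] fsubst_def[of _ P] fsubst_sum
  by (simp add: fsubst_mult fsubst_scalar fsubst_prod_list o_def)

lemma fsubst_cong:
  assumes "\<And>w x. w \<in> Poly_Mapping.keys P \<Longrightarrow> x \<in> set (letters w) \<Longrightarrow> g x = h x"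
  shows "fsubst g P = fsubst h P"
  unfolding fsubst_def
proof (rule sum.cong[OF refl])
  fix w assume "w \<in> Poly_Mapping.keys P"
  then have "map g (letters w) = map h (letters w)" using assms by (intro map_cong refl)
  then show "Poly_Mapping.single 0 (Poly_Mapping.lookup P w) * prod_list (map g (letters w)) =
    Poly_Mapping.single 0 (Poly_Mapping.lookup P w) * prod_list (map h (letters w))" by (simp only:)
qed


section \<open>Polynomials invariant under a deformation of two letters\<close>

text \<open>
  The letters \<open>Suc i\<close> and \<open>i\<close> play the roles of \<open>p\<close> and \<open>q\<close> in the introduction, so that \<open>i\<close> is coded
  by \<open>qp\<close> and \<open>Suc i\<close> by \<open>pq\<close>. The code is prefix-free: the codes of different letters begin with
  different letters.
\<close>

definition pcode :: "nat \<Rightarrow> nat \<Rightarrow> nat list" where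
  "pcode i x = (if x = i then [i, Suc i] else if x = Suc i then [Suc i, i] else [x])"

definition pcodes :: "nat \<Rightarrow> nat list \<Rightarrow> nat list" where
  "pcodes i w = concat (map (pcode i) w)"

lemma pcodes_simps [simp]: "pcodes i [] = []" "pcodes i (x # w) = pcode i x @ pcodes i w"
  by (simp_all add: pcodes_def)

text \<open>
  For \<open>e = Suc i\<close> the letters \<open>i\<close> and \<open>Suc i\<close> are sent to \<open>qp\<close> and \<open>p(q + 1)\<close>, for \<open>e = i\<close> to
  \<open>(q + 1)p\<close> and \<open>pq\<close>.
\<close>

definition twist :: "nat \<Rightarrow> nat \<Rightarrow> nat \<Rightarrow> nat fmon \<Rightarrow>\<^sub>0 'k::field" where
  "twist i e x = word (pcode i x) + (if x = e then word [Suc i] else 0)"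

definition twist_coeff :: "nat \<Rightarrow> nat \<Rightarrow> nat list \<Rightarrow> nat list \<Rightarrow> 'k::field" where
  "twist_coeff i e w s = Poly_Mapping.lookup (prod_list (map (twist i e) w)) (FMon s)"

lemma twist_coeff_Nil: "twist_coeff i e [] s = (if s = [] then 1 else (0::'k::field))"
  by (simp add: twist_coeff_def lookup_one zero_fmon_def when_def)

lemma twist_coeff_Cons:
  "twist_coeff i e (x # w) s =
    (if take (length (pcode i x)) s = pcode i x then twist_coeff i e w (drop (length (pcode i x)) s) else 0) +
    (if x = e \<and> take 1 s = [Suc i] then twist_coeff i e w (drop 1 s) else (0::'k::field))"
  by (simp add: twist_coeff_def twist_def distrib_right lookup_add lookup_word_mult)

text \<open>
  Choosing the short term \<open>p\<close> in a factor of a product of twisted letters raises the number of \<open>p\<close>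
  minus the number of \<open>q\<close> by one, and every other choice keeps it. This grading shows how often the
  short term was chosen.
\<close>

definition excess :: "nat \<Rightarrow> nat list \<Rightarrow> int" where
  "excess i s = int (count_list s (Suc i)) - int (count_list s i)"

lemma excess_append: "excess i (s @ t) = excess i s + excess i t"
  by (simp add: excess_def)

lemma excess_pcode: "excess i (pcode i x) = 0"
  by (simp add: excess_def pcode_def)

lemma excess_pcodes: "excess i (pcodes i w) = 0"
  by (induction w) (simp add: excess_def, simp add: excess_append excess_pcode)

lemma twist_coeff_negative: "excess i s < 0 \<Longrightarrow> twist_coeff i e w s = (0::'k::field)"
proof (induction w arbitrary: s)
  case Nil
  then show ?case by (auto simp: excess_def twist_coeff_Nil)
next
  case (Cons x w)
  have "excess i s = excess i (take k s) + excess i (drop k s)" for k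
    by (metis append_take_drop_id excess_append)
  then have "excess i (drop (length (pcode i x)) s) < 0" if "take (length (pcode i x)) s = pcode i x"
    using that Cons.prems by (metis add_0 excess_pcode)
  moreover have "excess i (drop 1 s) < 0" if "take 1 s = [Suc i]"
    using \<open>\<And>k. excess i s = excess i (take k s) + excess i (drop k s)\<close>[of 1] that Cons.prems
    by (simp add: excess_def)
  ultimately show ?case unfolding twist_coeff_Cons using Cons.IH by auto
qed

lemma twist_coeff_pcodes:
  assumes "e \<in> {i, Suc i}"
  shows "twist_coeff i e w (pcodes i v) = (if w = v then 1 else (0::'k::field))"
proof (induction v arbitrary: w)
  case Nil
  show ?case
    by (cases w) (auto simp: twist_coeff_Nil twist_coeff_Cons pcode_def)
next
  case (Cons y v)
  have neg: "twist_coeff i e w' (i # pcodes i v) = (0::'k)" for w'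
    by (rule twist_coeff_negative) (use excess_pcodes[of i v] in \<open>simp add: excess_def\<close>)
  show ?case
  proof (cases w)
    case Nil
    then show ?thesis by (simp add: twist_coeff_Nil pcode_def)
  next
    case (Cons x w')
    then show ?thesis
      using assms neg[of w'] Cons.IH[of w'] by (auto simp: twist_coeff_Cons pcode_def)
  qed
qed

text \<open>
  A string that begins with \<open>q\<close> can only come from a product whose first factor contributes \<open>qp\<close>. So the
  code of \<open>u\<close> begins with \<open>p\<close>, that is, with \<open>pq\<close>, and deleting \<open>qp\<close> leaves a string that begins with
  \<open>q\<close> again. Hence \<open>u\<close> would consist of letters \<open>Suc i\<close> only.
\<close>

lemma twist_coeff_shifted:
  assumes "e \<in> {i, Suc i}" "u \<noteq> []" "last u \<noteq> Suc i"
  shows "twist_coeff i e w (i # pcodes i u @ Suc i # s) = (0::'k::field)"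
  using assms(2,3)
proof (induction u arbitrary: w)
  case Nil
  then show ?case by simp
next
  case (Cons y u)
  show ?case
  proof (cases w)
    case Nil
    then show ?thesis by (simp add: twist_coeff_Nil)
  next
    case w: (Cons x w')
    show ?thesis
    proof (cases "x = i \<and> y = Suc i")
      case True
      then have "u \<noteq> []" "last u \<noteq> Suc i" using Cons.prems by (auto split: if_splits)
      then show ?thesis
        using True Cons.IH[of w'] by (simp add: w twist_coeff_Cons pcode_def)
    next
      case False
      then show ?thesis
        by (auto simp: w twist_coeff_Cons pcode_def)
    qed
  qed
qed

text \<open>
  In a string of excess one the short term is chosen exactly once. The position of the additional \<open>p\<close>
  is ambiguous only because \<open>pq \<cdot> p = p \<cdot> qp\<close>, so it is determined once \<open>u\<close> does not end with the
  letter coded by \<open>pq\<close> and \<open>v\<close> does not begin with the one coded by \<open>qp\<close>.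
\<close>

lemma twist_coeff_marked:
  assumes e: "e \<in> {i, Suc i}" and u: "u = [] \<or> last u \<noteq> Suc i" and v: "v = [] \<or> hd v \<noteq> i"
  shows "twist_coeff i e w (pcodes i u @ Suc i # pcodes i v) =
    (if w = u @ e # v then 1 else (0::'k::field))"
  using u
proof (induction u arbitrary: w)
  case Nil
  show ?case
  proof (cases w)
    case Nil
    then show ?thesis by (simp add: twist_coeff_Nil)
  next
    case (Cons x w')
    have "take (Suc 0) (pcodes i v) \<noteq> [i]"
      using v by (cases v) (auto simp: pcode_def)
    then show ?thesis
      using e by (auto simp: Cons twist_coeff_Cons pcode_def twist_coeff_pcodes)
  qed
next
  case (Cons y u)
  then have u: "u = [] \<or> last u \<noteq> Suc i" by auto
  show ?case
  proof (cases w)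
    case Nil
    then show ?thesis by (simp add: twist_coeff_Nil pcode_def)
  next
    case w: (Cons x w')
    have shifted: "twist_coeff i e w' (i # pcodes i u @ Suc i # pcodes i v) = (0::'k)" if "y = Suc i"
      using that Cons.prems by (intro twist_coeff_shifted[OF e]) (auto split: if_splits)
    show ?thesis
      using e shifted Cons.IH[OF u, of w'] by (auto simp: w twist_coeff_Cons pcode_def)
  qed
qed

lemma lookup_fsubst_twist:
  "Poly_Mapping.lookup (fsubst (twist i e) F) (FMon s) =
    (\<Sum>w\<in>Poly_Mapping.keys F. Poly_Mapping.lookup F w * twist_coeff i e (letters w) s)"
  by (simp add: fsubst_def lookup_sum lookup_scalar_mult twist_coeff_def)

text \<open>
  The conditions on \<open>u\<close> and \<open>v\<close> say that changing the letter \<open>i\<close> to \<open>Suc i\<close> leaves the descents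
  between it and its two neighbours unchanged.
\<close>

lemma lookup_eq_if_fsubst_twist_eq:
  fixes F :: "nat fmon \<Rightarrow>\<^sub>0 'k::field"
  assumes eq: "fsubst (twist i i) F = fsubst (twist i (Suc i)) F"
    and u: "u = [] \<or> last u \<noteq> Suc i" and v: "v = [] \<or> hd v \<noteq> i"
  shows "Poly_Mapping.lookup F (FMon (u @ i # v)) = Poly_Mapping.lookup F (FMon (u @ Suc i # v))"
proof -
  have "Poly_Mapping.lookup (fsubst (twist i e) F) (FMon (pcodes i u @ Suc i # pcodes i v)) =
      Poly_Mapping.lookup F (FMon (u @ e # v))" if e: "e \<in> {i, Suc i}" for e
  proof -
    have "letters w = u @ e # v \<longleftrightarrow> w = FMon (u @ e # v)" for w by (cases w) auto
    then show ?thesis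
      by (simp add: lookup_fsubst_twist twist_coeff_marked[OF e u v] if_distrib in_keys_iff cong: if_cong)
  qed
  from this[of i] this[of "Suc i"] show ?thesis using eq by simp
qed

section \<open>Two homomorphisms on \<open>Q\<^sub>n\<close> that differ only at one set\<close>

text \<open>
  The universal property of \<open>Q\<^sub>n\<close>: a substitution that kills the defining relations factors through
  the quotient.
\<close>

lemma fsubst_Qideal:
  fixes g :: "zgen \<Rightarrow> 'h fmon \<Rightarrow>\<^sub>0 'k::field"
  assumes g: "\<And>R. R \<in> relators n \<Longrightarrow> fsubst g R = 0" and P: "P \<in> Qideal n"
  shows "fsubst g P = 0"
proof -
  interpret F: ring "free_alg n :: 'k freealg ring" by (rule ring_free_alg)
  let ?K = "{P \<in> carrier (free_alg n). fsubst g P = 0}"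
  have minus: "\<ominus>\<^bsub>free_alg n\<^esub> x = - x" if "x \<in> carrier (free_alg n)" for x :: "'k freealg"
    using F.minus_equality[of "- x" x] that by (simp add: free_alg_closed)
  have "subgroup ?K (add_monoid (free_alg n))"
  proof (rule F.add.subgroupI)
    show "?K \<noteq> {}" using F.zero_closed by (auto simp del: F.zero_closed)
    fix a assume "a \<in> ?K"
    then have "a \<in> carrier (free_alg n)" "fsubst g a = 0" by blast+
    then show "\<ominus>\<^bsub>free_alg n\<^esub> a \<in> ?K"
      by (simp add: minus fsubst_uminus free_alg_closed(3))
  qed (auto simp: fsubst_add free_alg_closed)
  then have "ideal ?K (free_alg n)"
    by (intro idealI) (auto simp: F.ring_axioms fsubst_mult free_alg_closed)
  moreover have "relators n \<subseteq> ?K"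
    using g relators_subset by blast
  ultimately have "Qideal n \<subseteq> ?K"
    unfolding Qideal_def by (intro F.genideal_minimal)
  then show ?thesis using P by blast
qed

text \<open>
  Roots depend only on the number of elements already present: all paths then carry the same sequence
  of roots.
\<close>

definition flat :: "(nat \<Rightarrow> 'h fmon \<Rightarrow>\<^sub>0 'k::field) \<Rightarrow> zgen \<Rightarrow> 'h fmon \<Rightarrow>\<^sub>0 'k" where
  "flat t = (\<lambda>(A, j). t (Suc (card A)))"

text \<open>
  Differs from the flat choice only on the roots of the steps into and out of \<open>{1..i}\<close>.
\<close>

definition bent :: "nat \<Rightarrow> zgen \<Rightarrow> nat fmon \<Rightarrow>\<^sub>0 'k::field" where
  "bent i = (\<lambda>(A, j). twist i (if A = {1..i} \<or> insert j A = {1..i} then i else Suc i) (Suc (card A)))"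

lemma fsubst_free_gen: "fsubst g (free_gen A j) = g (A, j)"
  by (simp add: free_gen_def fsubst_single)

lemma relator_cases:
  assumes "R \<in> relators n"
  obtains A i j where "A \<subseteq> {1..n}" "i \<in> {1..n} - A" "j \<in> {1..n} - A" "i \<noteq> j"
    "R = (free_gen (insert i A) j + free_gen A i) - (free_gen (insert j A) i + free_gen A j) \<or>
     R = free_gen (insert i A) j * free_gen A i - free_gen (insert j A) i * free_gen A j"
  using assms unfolding relators_def by force

lemma flat_relator: "R \<in> relators n \<Longrightarrow> fsubst (flat t) R = 0"
proof (erule relator_cases)
  fix A i j assume "A \<subseteq> {1..n}" "i \<in> {1..n} - A" "j \<in> {1..n} - A"
    and R: "R = (free_gen (insert i A) j + free_gen A i) - (free_gen (insert j A) i + free_gen A j) \<or>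
     R = free_gen (insert i A) j * free_gen A i - free_gen (insert j A) i * free_gen A j"
  then have "card (insert i A) = Suc (card A)" "card (insert j A) = Suc (card A)"
    using finite_subset[of A "{1..n}"] by auto
  with R show ?thesis
    by (auto simp: fsubst_diff fsubst_add fsubst_mult fsubst_free_gen flat_def)
qed

text \<open>
  The two identities that allow the roots of two consecutive steps to be changed without changing their
  sum and product.
\<close>

lemma twist_sum: "twist i i (Suc i) + twist i i i = (twist i (Suc i) (Suc i) + twist i (Suc i) i :: nat fmon \<Rightarrow>\<^sub>0 'k::field)"
  by (simp add: twist_def pcode_def)

lemma twist_prod: "twist i i (Suc i) * twist i i i = (twist i (Suc i) (Suc i) * twist i (Suc i) i :: nat fmon \<Rightarrow>\<^sub>0 'k::field)"
  by (simp add: twist_def pcode_def distrib_left distrib_right flip: word_append)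

text \<open>
  In a square \<open>A\<close>, \<open>A \<union> {i}\<close>, \<open>A \<union> {j}\<close>, \<open>A \<union> {i, j}\<close> that has \<open>{1..m}\<close> in the middle,
  the roots on one side are deformed and those on the other are not, and the two identities above apply.
  If \<open>{1..m}\<close> is the top or the bottom, corresponding roots on both sides receive the same value.
\<close>

lemma bent_relator: "R \<in> relators n \<Longrightarrow> fsubst (bent m) R = (0 :: nat fmon \<Rightarrow>\<^sub>0 'k::field)"
proof (erule relator_cases)
  fix A i j assume A: "A \<subseteq> {1..n}" "i \<in> {1..n} - A" "j \<in> {1..n} - A" "i \<noteq> j"
    and R: "R = (free_gen (insert i A) j + free_gen A i) - (free_gen (insert j A) i + free_gen A j) \<or>
     R = free_gen (insert i A) j * free_gen A i - free_gen (insert j A) i * free_gen A j"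
  have fin: "finite A" using A finite_subset[of A "{1..n}"] by auto
  then have card: "card (insert i A) = Suc (card A)" "card (insert j A) = Suc (card A)"
    using A by auto
  have card2: "card (insert i (insert j A)) = Suc (Suc (card A))" using A fin by simp
  have ne: "insert i A \<noteq> insert j A" using A by blast
  have X: "card A = m" if "A = {1..m}" using that by simp
  have X1: "Suc (card A) = m" if "insert i A = {1..m} \<or> insert j A = {1..m}"
    using that card by (metis card_atLeastAtMost diff_Suc_1)
  have X2: "Suc (Suc (card A)) = m" if "insert i (insert j A) = {1..m}"
    using that card2 by (metis card_atLeastAtMost diff_Suc_1)
  define t where "t P = (twist m (if P then m else Suc m) :: nat \<Rightarrow> nat fmon \<Rightarrow>\<^sub>0 'k)" for P
  have vals:
    "bent m (insert i A, j) = t (insert i A = {1..m} \<or> insert i (insert j A) = {1..m}) (Suc (Suc (card A)))"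
    "bent m (insert j A, i) = t (insert j A = {1..m} \<or> insert i (insert j A) = {1..m}) (Suc (Suc (card A)))"
    "bent m (A, i) = t (A = {1..m} \<or> insert i A = {1..m}) (Suc (card A))"
    "bent m (A, j) = t (A = {1..m} \<or> insert j A = {1..m}) (Suc (card A))"
    by (simp_all only: t_def bent_def prod.case card insert_commute[of j i])
  have "bent m (insert i A, j) + bent m (A, i) = (bent m (insert j A, i) + bent m (A, j) :: nat fmon \<Rightarrow>\<^sub>0 'k) \<and>
    bent m (insert i A, j) * bent m (A, i) = (bent m (insert j A, i) * bent m (A, j) :: nat fmon \<Rightarrow>\<^sub>0 'k)"
  proof (cases "insert i A = {1..m} \<or> insert j A = {1..m}")
    case True
    then have "A \<noteq> {1..m}" "insert i (insert j A) \<noteq> {1..m}" using X X1 X2 by force+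
    moreover have "insert i A = {1..m} \<longleftrightarrow> insert j A \<noteq> {1..m}" using True ne by metis
    ultimately show ?thesis
      unfolding vals X1[OF True]
      using twist_sum[of m, where 'k = 'k] twist_prod[of m, where 'k = 'k] by (simp add: t_def)
  next
    case False
    then show ?thesis unfolding vals by simp
  qed
  with R show ?thesis
    by (elim disjE) (simp_all only: fsubst_diff fsubst_add fsubst_mult fsubst_free_gen simp_thms diff_self)
qed

section \<open>Words, their block shapes, and ribbon sums\<close>

text \<open>
  The maximal descending runs of a word inside blocks, each recorded by its block and its length; the
  function \<open>b\<close> labels every letter with its block.
\<close>

fun shape :: "(nat \<Rightarrow> 'b) \<Rightarrow> nat list \<Rightarrow> ('b \<times> nat) list" where
  "shape b [] = []"
| "shape b (x # w) = (case shape b w of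
     [] \<Rightarrow> [(b x, 1)]
   | (J, l) # s \<Rightarrow> if J = b x \<and> hd w < x then (J, Suc l) # s else (b x, 1) # (J, l) # s)"

definition run :: "(nat \<Rightarrow> 'b) \<Rightarrow> 'b \<Rightarrow> nat list \<Rightarrow> bool" where
  "run b J xs \<longleftrightarrow> xs \<noteq> [] \<and> sorted_wrt (>) xs \<and> (\<forall>x\<in>set xs. b x = J)"

lemma shape_eq_Nil_iff [simp]: "shape b w = [] \<longleftrightarrow> w = []"
  by (cases w) (auto split: list.splits)

lemma shape_run_append:
  assumes "run b J xs"
  shows "shape b (xs @ w) = (case shape b w of
     [] \<Rightarrow> [(J, length xs)]
   | (K, l) # s \<Rightarrow> if K = J \<and> hd w < last xs then (J, length xs + l) # s
       else (J, length xs) # (K, l) # s)"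
  using assms
proof (induction xs)
  case Nil
  then show ?case by (simp add: run_def)
next
  case (Cons x xs)
  show ?case
  proof (cases "xs = []")
    case True
    then show ?thesis using Cons.prems by (auto simp: run_def split: list.splits)
  next
    case False
    then have "run b J xs" "hd xs < x" "b x = J"
      using Cons.prems by (auto simp: run_def)
    then show ?thesis using Cons.IH False by (auto split: list.splits)
  qed
qed

lemma shape_decompose:
  assumes "shape b w = (J, l) # s"
  obtains xs ys where "w = xs @ ys" "run b J xs" "length xs = l" "shape b ys = s"
    "ys = [] \<or> b (hd ys) \<noteq> J \<or> last xs \<le> hd ys"
proof -
  have "\<exists>xs ys. w = xs @ ys \<and> run b J xs \<and> length xs = l \<and> shape b ys = s \<and>
    (ys = [] \<or> b (hd ys) \<noteq> J \<or> last xs \<le> hd ys)"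
    using assms
  proof (induction w arbitrary: J l s)
    case Nil
    then show ?case by simp
  next
    case (Cons x w)
    show ?case
    proof (cases "shape b w")
      case Nil
      then show ?thesis using Cons.prems
        by (intro exI[of _ "[x]"] exI[of _ "[]"]) (auto simp: run_def)
    next
      case w: (Cons a s')
      obtain K k where a: "a = (K, k)" by fastforce
      from Cons.IH[OF w[unfolded a]] obtain xs ys where
        *: "w = xs @ ys" "run b K xs" "length xs = k" "shape b ys = s'"
          "ys = [] \<or> b (hd ys) \<noteq> K \<or> last xs \<le> hd ys" by blast
      then have "xs \<noteq> []" and hd: "b (hd w) = K" by (auto simp: run_def)
      show ?thesis
      proof (cases "K = b x \<and> hd w < x")
        case True
        then have "run b J (x # xs)"
          using * Cons.prems w a by (cases xs) (auto simp: run_def)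
        then show ?thesis
          using * Cons.prems w a True \<open>xs \<noteq> []\<close>
          by (intro exI[of _ "x # xs"] exI[of _ ys]) auto
      next
        case False
        then show ?thesis
          using * hd Cons.prems w a
          by (intro exI[of _ "[x]"] exI[of _ w]) (auto simp: run_def)
      qed
    qed
  qed
  then show thesis using that by blast
qed

lemma length_shape: "length w = sum_list (map snd (shape b w))"
  by (induction w) (auto split: list.splits)

lemma shape_label: "(J, l) \<in> set (shape b w) \<Longrightarrow> J \<in> b ` set w"
  by (induction w arbitrary: J l) (fastforce split: list.splits if_splits)+

lemma shape_pos: "(J, l) \<in> set (shape b w) \<Longrightarrow> 0 < l"
  by (induction w arbitrary: J l) (fastforce split: list.splits if_splits)+

text \<open>
  The blocks are the fibres of a labelling that is constant between any two letters of the same label,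
  so that they are intervals.
\<close>

locale interval_labelling =
  fixes n :: nat and b :: "nat \<Rightarrow> 'b"
  assumes between: "\<lbrakk>1 \<le> x; x \<le> y; y \<le> z; z \<le> n; b x = b z\<rbrakk> \<Longrightarrow> b y = b z"
begin

definition fiber :: "'b \<Rightarrow> nat set" where
  "fiber J = {x \<in> {1..n}. b x = J}"

text \<open>
  The word with letters as small as possible among those of a given shape.
\<close>

definition canon :: "('b \<times> nat) list \<Rightarrow> nat list" where
  "canon s = concat (map (\<lambda>(J, l). rev [Min (fiber J)..<Min (fiber J) + l]) s)"

lemma finite_fiber [simp]: "finite (fiber J)"
  by (simp add: fiber_def)

lemma run_length_le:
  assumes "run b J xs" "set xs \<subseteq> {1..n}"
  shows "Min (fiber J) + length xs \<le> Suc (hd xs)"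
  using assms
proof (induction xs)
  case Nil
  then show ?case by (simp add: run_def)
next
  case (Cons x xs)
  show ?case
  proof (cases "xs = []")
    case True
    then have "x \<in> fiber J" using Cons.prems by (auto simp: run_def fiber_def)
    then show ?thesis using True by simp
  next
    case False
    then have "run b J xs" "hd xs < x" using Cons.prems by (auto simp: run_def)
    then show ?thesis using Cons by auto
  qed
qed

text \<open>
  The condition on \<open>u\<close> and \<open>v\<close> is that the replacement neither creates nor destroys a descent.
\<close>

definition move_invariant :: "(nat list \<Rightarrow> 'c) \<Rightarrow> bool" where
  "move_invariant c \<longleftrightarrow> (\<forall>i u v. 1 \<le> i \<and> i < n \<and> b i = b (Suc i) \<and>
     (u = [] \<or> last u \<noteq> Suc i) \<and> (v = [] \<or> hd v \<noteq> i) \<longrightarrow> c (u @ i # v) = c (u @ Suc i # v))"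

lemma lower_letter:
  assumes c: "move_invariant c"
    and "1 \<le> y" "y \<le> x" "x \<le> n" "b x = b y"
    and "u = [] \<or> last u \<notin> {y<..x}" "v = [] \<or> hd v \<notin> {y..<x}"
  shows "c (u @ x # v) = c (u @ y # v)"
  using assms(3-)
proof (induction x)
  case 0
  then show ?case by simp
next
  case (Suc x)
  show ?case
  proof (cases "y = Suc x")
    case False
    then have yx: "y \<le> x" using Suc.prems by simp
    have bx: "b x = b (Suc x)"
      by (rule between[of y]) (use yx Suc.prems \<open>1 \<le> y\<close> in auto)
    have "c (u @ x # v) = c (u @ Suc x # v)"
      using c[unfolded move_invariant_def, rule_format, of x u v] bx yx Suc.prems \<open>1 \<le> y\<close> by auto
    moreover have "c (u @ x # v) = c (u @ y # v)"
      using yx bx Suc.prems by (intro Suc.IH) auto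
    ultimately show ?thesis by simp
  qed simp
qed

text \<open>
  The letters of a run are lowered from the last to the first, so that the part of the run after the
  letter being lowered is already minimal and lies below all its values. A letter of the same block in
  front of the run is larger than the whole run or the smallest letter of the block, so it compares in
  the same way with all values that the first letter of the run takes.
\<close>

lemma lower_run:
  assumes c: "move_invariant c" and "run b J xs" "set xs \<subseteq> {1..n}"
    and "u = [] \<or> b (last u) \<noteq> J \<or> last u = Min (fiber J) \<or> hd xs < last u"
    and "v = [] \<or> b (hd v) \<noteq> J \<or> last xs \<le> hd v"
  shows "c (u @ xs @ v) = c (u @ rev [Min (fiber J)..<Min (fiber J) + length xs] @ v)"
  using assms(2-)
proof (induction xs arbitrary: u)
  case Nil
  then show ?case by (simp add: run_def)
next
  case (Cons x xs)
  define y where "y = Min (fiber J) + length xs"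
  define ys where "ys = rev [Min (fiber J)..<Min (fiber J) + length xs]"
  have J: "b x = J" and xn: "x \<in> {1..n}" using Cons.prems by (auto simp: run_def)
  then have x: "x \<in> fiber J" by (simp add: fiber_def)
  then have "Min (fiber J) \<in> fiber J" by (intro Min_in) auto
  then have m: "1 \<le> Min (fiber J)" "b (Min (fiber J)) = J" by (auto simp: fiber_def)
  have yx: "y \<le> x" using run_length_le[OF Cons.prems(1,2)] by (simp add: y_def)
  have btw: "b z = J" if "Min (fiber J) \<le> z" "z \<le> x" for z
    using between[of "Min (fiber J)" z x] that m J xn by auto
  have "c (u @ (x # xs) @ v) = c (u @ x # ys @ v)"
  proof (cases "xs = []")
    case True
    then show ?thesis by (simp add: ys_def)
  next
    case False
    then have "run b J xs" "hd xs < x" using Cons.prems by (auto simp: run_def)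
    then show ?thesis
      using Cons.IH[of "u @ [x]"] Cons.prems False by (simp add: ys_def)
  qed
  also have "\<dots> = c (u @ y # ys @ v)"
  proof (rule lower_letter[OF c])
    show "1 \<le> y" "y \<le> x" "x \<le> n" using m yx xn by (auto simp: y_def)
    show "b x = b y" using btw[of y] yx J by (simp add: y_def)
    show "u = [] \<or> last u \<notin> {y<..x}"
      using Cons.prems(3) btw[of "last u"] by (auto simp: y_def)
    show "ys @ v = [] \<or> hd (ys @ v) \<notin> {y..<x}"
    proof (cases "xs = []")
      case True
      then show ?thesis using Cons.prems(4) btw[of "hd v"] by (auto simp: y_def ys_def)
    next
      case False
      then obtain k where "length xs = Suc k" by (cases xs) auto
      then show ?thesis by (simp add: y_def ys_def)
    qed
  qed
  finally show ?case
    by (simp add: y_def ys_def)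
qed

text \<open>
  Runs are lowered from left to right, so the part \<open>u\<close> that is already treated ends with the
  smallest letter of a block, as lowering the next run requires.
\<close>

lemma move_invariant_canon_aux:
  assumes c: "move_invariant c"
  shows "set w \<subseteq> {1..n} \<Longrightarrow> u = [] \<or> (last u \<in> {1..n} \<and> last u = Min (fiber (b (last u)))) \<Longrightarrow>
    c (u @ w) = c (u @ canon (shape b w))"
proof (induction "shape b w" arbitrary: u w)
  case Nil
  then have "w = []" by (metis shape_eq_Nil_iff)
  then show ?case by (simp add: canon_def)
next
  case (Cons a s)
  obtain J l where a: "a = (J, l)" by fastforce
  obtain xs ys where d: "w = xs @ ys" "run b J xs" "length xs = l" "shape b ys = s"
    "ys = [] \<or> b (hd ys) \<noteq> J \<or> last xs \<le> hd ys"
    using shape_decompose[of b w J l s] Cons.hyps(2) a by metis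
  let ?R = "rev [Min (fiber J)..<Min (fiber J) + l]"
  have xs: "xs \<noteq> []" "set xs \<subseteq> {1..n}" using d Cons.prems by (auto simp: run_def)
  then have "hd xs \<in> set xs" "hd xs \<in> {1..n}" using hd_in_set[of xs] by blast+
  then have "hd xs \<in> fiber J" using d(2) by (auto simp: run_def fiber_def)
  then have "Min (fiber J) \<in> fiber J" by (intro Min_in) auto
  then have m: "Min (fiber J) \<in> {1..n}" "b (Min (fiber J)) = J" by (auto simp: fiber_def)
  have l: "0 < l" using d xs by auto
  have last: "last ?R = Min (fiber J)" "?R \<noteq> []"
    using l by (simp_all add: last_rev)
  have "c (u @ xs @ ys) = c (u @ ?R @ ys)"
    using lower_run[OF c d(2) xs(2) _ d(5), of u] Cons.prems d(3) by auto
  also have "\<dots> = c ((u @ ?R) @ canon (shape b ys))"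
    using Cons.hyps(1)[of ys "u @ ?R"] d Cons.prems m last by auto
  also have "(u @ ?R) @ canon (shape b ys) = u @ canon (shape b w)"
    using a d(3,4) Cons.hyps(2)[symmetric] by (simp add: canon_def)
  finally show ?case using d by simp
qed

lemma move_invariant_canon:
  "move_invariant c \<Longrightarrow> set w \<subseteq> {1..n} \<Longrightarrow> c w = c (canon (shape b w))"
  using move_invariant_canon_aux[of c w "[]"] by simp

definition ribbon :: "('b \<times> nat) list \<Rightarrow> nat fmon \<Rightarrow>\<^sub>0 'k::field" where
  "ribbon s = (\<Sum>w\<in>{w. set w \<subseteq> {1..n} \<and> shape b w = s}. word w)"

lemma finite_shape: "finite {w. set w \<subseteq> {1..n} \<and> shape b w = s}"
  by (rule finite_subset[OF _ finite_lists_length_eq[of "{1..n}" "sum_list (map snd s)"]])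
     (auto simp: length_shape[of _ b])

end

definition decreasing_lists :: "nat \<Rightarrow> nat set \<Rightarrow> nat list set" where
  "decreasing_lists m I = {xs. length xs = m \<and> sorted_wrt (>) xs \<and> set xs \<subseteq> I}"

definition elem_sym :: "nat \<Rightarrow> nat set \<Rightarrow> nat fmon \<Rightarrow>\<^sub>0 'k::field" where
  "elem_sym m I = (\<Sum>xs\<in>decreasing_lists m I. word xs)"

lemma finite_decreasing_lists: "finite I \<Longrightarrow> finite (decreasing_lists m I)"
  by (rule finite_subset[OF _ finite_lists_length_eq[of I m]]) (auto simp: decreasing_lists_def)

context interval_labelling
begin

lemma run_iff_decreasing:
  "xs \<in> decreasing_lists m (fiber J) \<and> 0 < m \<longleftrightarrow> run b J xs \<and> set xs \<subseteq> {1..n} \<and> length xs = m"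
  by (auto simp: decreasing_lists_def run_def fiber_def)

lemma ribbon_Nil: "ribbon [] = 1"
  by (simp add: ribbon_def word_Nil cong: conj_cong)

lemma ribbon_singleton:
  assumes "0 < m"
  shows "ribbon [(J, m)] = elem_sym m (fiber J)"
proof -
  have "{w. set w \<subseteq> {1..n} \<and> shape b w = [(J, m)]} = decreasing_lists m (fiber J)"
  proof (intro Set.set_eqI iffI)
    fix w assume "w \<in> {w. set w \<subseteq> {1..n} \<and> shape b w = [(J, m)]}"
    then have w: "set w \<subseteq> {1..n}" "shape b w = [(J, m)]" by auto
    from shape_decompose[OF w(2)] obtain xs ys where "w = xs @ ys" "run b J xs" "length xs = m" "shape b ys = []"
      by metis
    then show "w \<in> decreasing_lists m (fiber J)"
      using w run_iff_decreasing[of w m J] by auto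
  next
    fix w assume "w \<in> decreasing_lists m (fiber J)"
    then have "run b J w" "set w \<subseteq> {1..n}" "length w = m"
      using assms run_iff_decreasing[of w m J] by auto
    then show "w \<in> {w. set w \<subseteq> {1..n} \<and> shape b w = [(J, m)]}"
      using shape_run_append[of b J w "[]"] by auto
  qed
  then show ?thesis by (simp add: ribbon_def elem_sym_def)
qed

text \<open>
  A descending run of length \<open>m\<close> in \<open>J\<close> in front of a word whose first run has length \<open>l\<close> in \<open>K\<close> either
  stays a run of its own or merges with that run.
\<close>

lemma ribbon_Cons:
  assumes m: "0 < m" and l: "0 < l"
  shows "elem_sym m (fiber J) * ribbon ((K, l) # s) =
    ribbon ((J, m) # (K, l) # s) + (if J = K then ribbon ((J, m + l) # s) else (0::nat fmon \<Rightarrow>\<^sub>0 'k::field))"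
proof -
  define W where "W s = {w. set w \<subseteq> {1..n} \<and> shape b w = s}" for s
  define D where "D = decreasing_lists m (fiber J)"
  define U where "U = W ((J, m) # (K, l) # s) \<union> (if J = K then W ((J, m + l) # s) else {})"
  have img: "(\<lambda>(xs, ys). xs @ ys) ` (D \<times> W ((K, l) # s)) = U"
  proof (intro Set.set_eqI iffI)
    fix w assume "w \<in> (\<lambda>(xs, ys). xs @ ys) ` (D \<times> W ((K, l) # s))"
    then obtain xs ys where w: "w = xs @ ys" "xs \<in> D" "ys \<in> W ((K, l) # s)" by auto
    then have "run b J xs" "set xs \<subseteq> {1..n}" "length xs = m"
      using m run_iff_decreasing[of xs m J] by (auto simp: D_def)
    then show "w \<in> U"
      using w shape_run_append[of b J xs ys] by (auto simp: U_def W_def)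
  next
    fix w assume "w \<in> U"
    then consider "w \<in> W ((J, m) # (K, l) # s)" | "J = K" "w \<in> W ((J, m + l) # s)"
      by (auto simp: U_def split: if_splits)
    then show "w \<in> (\<lambda>(xs, ys). xs @ ys) ` (D \<times> W ((K, l) # s))"
    proof cases
      case 1
      then have w: "set w \<subseteq> {1..n}" "shape b w = (J, m) # (K, l) # s" by (auto simp: W_def)
      obtain xs ys where "w = xs @ ys" "run b J xs" "length xs = m" "shape b ys = (K, l) # s"
        by (rule shape_decompose[OF w(2)])
      then have "xs \<in> D" "ys \<in> W ((K, l) # s)"
        using w m run_iff_decreasing[of xs m J] by (auto simp: D_def W_def)
      then show ?thesis using \<open>w = xs @ ys\<close> by force
    next
      case 2
      then have w: "set w \<subseteq> {1..n}" "shape b w = (J, m + l) # s" by (auto simp: W_def)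
      obtain zs ys where d: "w = zs @ ys" "run b J zs" "length zs = m + l" "shape b ys = s"
        "ys = [] \<or> b (hd ys) \<noteq> J \<or> last zs \<le> hd ys"
        by (rule shape_decompose[OF w(2)])
      define xs where "xs = take m zs"
      define vs where "vs = drop m zs"
      have zs: "zs = xs @ vs" "length xs = m" "length vs = l" using d by (auto simp: xs_def vs_def)
      then have "xs \<noteq> []" "vs \<noteq> []" using m l by auto
      then have r: "run b J xs" "run b J vs" "last zs = last vs"
        using d(2) zs(1) by (auto simp: run_def sorted_wrt_append)
      have "xs \<in> D" using w d zs r(1) run_iff_decreasing[of xs m J] m by (auto simp: D_def)
      moreover have "shape b (vs @ ys) = (J, l) # s"
      proof (cases "shape b ys")
        case Nil
        then show ?thesis using shape_run_append[OF r(2), of ys] d zs by simp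
      next
        case (Cons a s')
        obtain K' k where a: "a = (K', k)" by fastforce
        have "b (hd ys) = K'"
          using shape_decompose[OF Cons[unfolded a]] by (metis hd_append2 list.set_sel(1) run_def)
        \<comment> \<open>The run of \<open>w\<close> was maximal, so cutting it leaves a maximal run on the right.\<close>
        then have "\<not> (K' = J \<and> hd ys < last vs)"
          using d(5) r(3) Cons by auto
        then show ?thesis using shape_run_append[OF r(2), of ys] d zs Cons a by auto
      qed
      then have "vs @ ys \<in> W ((K, l) # s)" using 2 w d zs by (auto simp: W_def)
      ultimately show ?thesis using d(1) zs(1) by force
    qed
  qed
  have inj: "inj_on (\<lambda>(xs, ys). xs @ ys) (D \<times> W ((K, l) # s))"
    by (auto simp: inj_on_def D_def decreasing_lists_def)
  have "elem_sym m (fiber J) * ribbon ((K, l) # s) =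
      (\<Sum>(xs, ys)\<in>D \<times> W ((K, l) # s). word (xs @ ys) :: nat fmon \<Rightarrow>\<^sub>0 'k)"
    by (simp add: elem_sym_def ribbon_def sum_product word_append sum.cartesian_product D_def W_def)
  also have "\<dots> = (\<Sum>w\<in>U. word w)"
    unfolding img[symmetric] sum.reindex[OF inj] by (simp add: case_prod_beta)
  also have "\<dots> = (\<Sum>w\<in>W ((J, m) # (K, l) # s). word w) +
      (\<Sum>w\<in>(if J = K then W ((J, m + l) # s) else {}). word w)"
    unfolding U_def by (rule sum.union_disjoint) (use finite_shape l in \<open>auto simp: W_def\<close>)
  finally show ?thesis by (simp add: ribbon_def W_def)
qed

text \<open>
  Solving the multiplication rule for its first term expresses a ribbon by an elementary function and
  ribbons with fewer runs.
\<close>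

lemma ribbon_in_closed:
  fixes C :: "(nat fmon \<Rightarrow>\<^sub>0 'k::field) set"
  assumes one: "1 \<in> C" and diff: "\<And>p q. p \<in> C \<Longrightarrow> q \<in> C \<Longrightarrow> p - q \<in> C"
    and mult: "\<And>p q. p \<in> C \<Longrightarrow> q \<in> C \<Longrightarrow> p * q \<in> C"
    and elem: "\<And>J m. J \<in> b ` {1..n} \<Longrightarrow> 0 < m \<Longrightarrow> elem_sym m (fiber J) \<in> C"
  shows "(\<forall>(J, l)\<in>set s. J \<in> b ` {1..n} \<and> 0 < l) \<Longrightarrow> ribbon s \<in> C"
proof (induction "length s" arbitrary: s rule: less_induct)
  case less
  have zero: "0 \<in> C" using diff[OF one one] by simp
  consider "s = []" | J m where "s = [(J, m)]" | J m K l s' where "s = (J, m) # (K, l) # s'"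
    by (metis list.exhaust prod.exhaust)
  then show ?case
  proof cases
    case 1
    then show ?thesis by (simp add: ribbon_Nil one)
  next
    case 2
    then show ?thesis using less.prems elem by (simp add: ribbon_singleton)
  next
    case 3
    then have pos: "0 < m" "0 < l" "J \<in> b ` {1..n}" using less.prems by auto
    have "ribbon s = elem_sym m (fiber J) * ribbon ((K, l) # s') -
        (if J = K then ribbon ((J, m + l) # s') else (0 :: nat fmon \<Rightarrow>\<^sub>0 'k))"
      using ribbon_Cons[OF pos(1,2), of J K s', where 'k = 'k] 3 by simp
    moreover have "ribbon ((K, l) # s') \<in> C" "ribbon ((J, m + l) # s') \<in> C"
      using less.hyps less.prems 3 by auto
    ultimately show ?thesis
      using diff mult elem[OF pos(3,1)] zero by auto
  qed
qed

lemma move_invariant_in_closed: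
  fixes C :: "(nat fmon \<Rightarrow>\<^sub>0 'k::field) set"
  assumes one: "1 \<in> C" and add: "\<And>p q. p \<in> C \<Longrightarrow> q \<in> C \<Longrightarrow> p + q \<in> C"
    and scal: "\<And>a. Poly_Mapping.single 0 a \<in> C"
    and mult: "\<And>p q. p \<in> C \<Longrightarrow> q \<in> C \<Longrightarrow> p * q \<in> C"
    and elem: "\<And>J m. J \<in> b ` {1..n} \<Longrightarrow> 0 < m \<Longrightarrow> elem_sym m (fiber J) \<in> C"
    and F: "\<And>w. w \<in> Poly_Mapping.keys F \<Longrightarrow> set (letters w) \<subseteq> {1..n}"
    and inv: "move_invariant (\<lambda>w. Poly_Mapping.lookup F (FMon w))"
  shows "F \<in> C"
proof -
  \<comment> \<open>\<open>F\<close> is constant on each shape, so it is a combination of the ribbons of the shapes in its support.\<close>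
  define T where "T = (\<lambda>w. shape b (letters w)) ` Poly_Mapping.keys F"
  define g where "g s = Poly_Mapping.lookup F (FMon (canon s))" for s
  have T: "finite T" by (simp add: T_def)
  have lookup_ribbon: "Poly_Mapping.lookup (ribbon s :: nat fmon \<Rightarrow>\<^sub>0 'k) (FMon w) =
      (if set w \<subseteq> {1..n} \<and> shape b w = s then 1 else 0)" for s w
    using finite_shape[of s] by (auto simp: ribbon_def lookup_sum word_def lookup_single when_def)
  have "F = (\<Sum>s\<in>T. Poly_Mapping.single 0 (g s) * ribbon s)"
  proof (rule poly_mapping_eqI)
    fix w' :: "nat fmon"
    obtain w where w': "w' = FMon w" by (cases w')
    have "Poly_Mapping.lookup (\<Sum>s\<in>T. Poly_Mapping.single 0 (g s) * ribbon s) (FMon w) =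
        (\<Sum>s\<in>T. if s = shape b w then (if set w \<subseteq> {1..n} then g s else 0) else 0)"
      by (auto simp: lookup_sum lookup_scalar_mult lookup_ribbon intro!: sum.cong)
    also have "\<dots> = (if shape b w \<in> T \<and> set w \<subseteq> {1..n} then g (shape b w) else 0)"
      using T by simp
    also have "\<dots> = Poly_Mapping.lookup F (FMon w)"
    proof (cases "set w \<subseteq> {1..n}")
      case True
      then have *: "Poly_Mapping.lookup F (FMon w) = g (shape b w)"
        using move_invariant_canon[OF inv] by (simp add: g_def)
      show ?thesis
      proof (cases "shape b w \<in> T")
        case False
        then have "FMon w \<notin> Poly_Mapping.keys F" by (force simp: T_def)
        then show ?thesis using False by (simp add: in_keys_iff)
      qed (use * True in simp)
    next
      case False
      then have "FMon w \<notin> Poly_Mapping.keys F" using F by fastforce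
      then show ?thesis using False by (simp add: in_keys_iff)
    qed
    finally show "Poly_Mapping.lookup F w' = Poly_Mapping.lookup (\<Sum>s\<in>T. Poly_Mapping.single 0 (g s) * ribbon s) w'"
      by (simp add: w')
  qed
  moreover have "(\<Sum>s\<in>T. Poly_Mapping.single 0 (g s) * ribbon s) \<in> C"
  proof -
    have diff: "p - q \<in> C" if "p \<in> C" "q \<in> C" for p q
      using add[OF that(1) mult[OF scal[of "-1"] that(2)]] by (simp add: single_uminus)
    have "ribbon s \<in> C" if "s \<in> T" for s
    proof (rule ribbon_in_closed[OF one diff mult elem])
      from that obtain w where "w \<in> Poly_Mapping.keys F" "s = shape b (letters w)" by (auto simp: T_def)
      then show "\<forall>(J, l)\<in>set s. J \<in> b ` {1..n} \<and> 0 < l"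
        using shape_label[of _ _ b "letters w"] shape_pos[of _ _ b "letters w"] F by fastforce
    qed
    moreover have "0 \<in> C" using diff[OF one one] by simp
    ultimately show ?thesis using T
      by (induction T rule: infinite_finite_induct) (auto intro!: add mult scal)
  qed
  ultimately show ?thesis by simp
qed

end

section \<open>Subalgebras of \<open>Q\<^sub>n\<close>\<close>

lemma Qproj_closed: "p \<in> carrier (free_alg n) \<Longrightarrow> Qproj n p \<in> carrier (Qalg n)"
  by (simp add: carrier_Qalg)

lemma Qproj_simps:
  fixes p q :: "'k::field freealg"
  assumes "p \<in> carrier (free_alg n)" "q \<in> carrier (free_alg n)"
  shows "Qproj n (p + q) = Qproj n p \<oplus>\<^bsub>Qalg n\<^esub> Qproj n q"
    and "Qproj n (p * q) = Qproj n p \<otimes>\<^bsub>Qalg n\<^esub> Qproj n q"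
    and "Qproj n (- p) = \<ominus>\<^bsub>Qalg n\<^esub> Qproj n p"
proof -
  interpret h: ring_hom_ring "free_alg n" "Qalg n" "Qproj n :: 'k freealg \<Rightarrow> _" by (rule Qproj_hom)
  show "Qproj n (p + q) = Qproj n p \<oplus>\<^bsub>Qalg n\<^esub> Qproj n q"
    and "Qproj n (p * q) = Qproj n p \<otimes>\<^bsub>Qalg n\<^esub> Qproj n q"
    using h.hom_add[OF assms] h.hom_mult[OF assms] by simp_all
  have "\<ominus>\<^bsub>free_alg n\<^esub> p = - p"
    using h.R.minus_equality[of "- p" p] assms by (simp add: free_alg_closed)
  then show "Qproj n (- p) = \<ominus>\<^bsub>Qalg n\<^esub> Qproj n p"
    using h.hom_a_inv[OF assms(1)] by simp
qed

lemma Qproj_one: "Qproj n 1 = (\<one>\<^bsub>Qalg n\<^esub> :: 'k::field freealg set)"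
  and Qproj_zero: "Qproj n 0 = (\<zero>\<^bsub>Qalg n\<^esub> :: 'k::field freealg set)"
proof -
  interpret h: ring_hom_ring "free_alg n" "Qalg n" "Qproj n :: 'k freealg \<Rightarrow> _" by (rule Qproj_hom)
  show "Qproj n 1 = (\<one>\<^bsub>Qalg n\<^esub> :: 'k freealg set)" "Qproj n 0 = (\<zero>\<^bsub>Qalg n\<^esub> :: 'k freealg set)"
    using h.hom_one h.hom_zero by simp_all
qed

lemma zero_in_free_alg: "0 \<in> carrier (free_alg n)"
  by (simp add: in_free_alg_iff)

lemma sum_in_free_alg:
  "(\<And>x. x \<in> X \<Longrightarrow> f x \<in> carrier (free_alg n)) \<Longrightarrow> sum f X \<in> carrier (free_alg n)"
  by (induction X rule: infinite_finite_induct) (simp_all add: zero_in_free_alg free_alg_closed)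

lemma prod_list_in_free_alg:
  "(\<And>p. p \<in> set ps \<Longrightarrow> p \<in> carrier (free_alg n)) \<Longrightarrow> prod_list ps \<in> carrier (free_alg n)"
  by (induction ps) (simp_all add: one_in_free_alg free_alg_closed)

lemma Qproj_sum:
  fixes f :: "'b \<Rightarrow> 'k::field freealg"
  assumes "finite X" "\<And>x. x \<in> X \<Longrightarrow> f x \<in> carrier (free_alg n)"
  shows "Qproj n (sum f X) = (\<Oplus>\<^bsub>Qalg n\<^esub>x\<in>X. Qproj n (f x))"
  using assms
proof (induction X rule: finite_induct)
  interpret Q: ring "Qalg n :: 'k freealg set ring" by (rule ring_Qalg)
  {
    case empty
    then show ?case by (simp add: Qproj_zero)
  next
    case (insert x X)
    then show ?case
      by (subst Q.finsum_insert) (auto simp: Qproj_simps sum_in_free_alg Qproj_closed)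
  }
qed

lemma Qproj_prod_list:
  fixes ps :: "'k::field freealg list"
  assumes "\<And>p. p \<in> set ps \<Longrightarrow> p \<in> carrier (free_alg n)"
  shows "Qproj n (prod_list ps) = foldr (\<otimes>\<^bsub>Qalg n\<^esub>) (map (Qproj n) ps) \<one>\<^bsub>Qalg n\<^esub>"
  using assms by (induction ps) (simp_all add: Qproj_one Qproj_simps prod_list_in_free_alg)

definition polys_on :: "'g set \<Rightarrow> ('g fmon \<Rightarrow>\<^sub>0 'k::field) set" where
  "polys_on X = {F. \<forall>w\<in>Poly_Mapping.keys F. set (letters w) \<subseteq> X}"

text \<open>
  Subalgebras of \<open>Q\<^sub>n\<close> are handled through their preimages in the free algebra, where the ring
  operations are those of a type class and need no carrier.
\<close>

definition free_subalgebra :: "nat \<Rightarrow> 'k::field freealg set \<Rightarrow> bool" where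
  "free_subalgebra n C \<longleftrightarrow> C \<subseteq> carrier (free_alg n) \<and> (\<forall>c. Poly_Mapping.single 0 c \<in> C) \<and>
    (\<forall>p\<in>C. \<forall>q\<in>C. p + q \<in> C \<and> p * q \<in> C)"

lemma free_subalgebra_closed:
  assumes "free_subalgebra n C"
  shows "1 \<in> C" "0 \<in> C" "\<And>p. p \<in> C \<Longrightarrow> - p \<in> C" "\<And>p q. p \<in> C \<Longrightarrow> q \<in> C \<Longrightarrow> p - q \<in> C"
    "\<And>p q. p \<in> C \<Longrightarrow> q \<in> C \<Longrightarrow> p + q \<in> C" "\<And>p q. p \<in> C \<Longrightarrow> q \<in> C \<Longrightarrow> p * q \<in> C"
    "\<And>c. Poly_Mapping.single 0 c \<in> C"
proof -
  show scal: "\<And>c. Poly_Mapping.single 0 c \<in> C"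
    and add: "\<And>p q. p \<in> C \<Longrightarrow> q \<in> C \<Longrightarrow> p + q \<in> C" and mult: "\<And>p q. p \<in> C \<Longrightarrow> q \<in> C \<Longrightarrow> p * q \<in> C"
    using assms by (auto simp: free_subalgebra_def)
  show "1 \<in> C" "0 \<in> C" using scal[of 1] scal[of 0] by simp_all
  show neg: "- p \<in> C" if "p \<in> C" for p
    using mult[OF scal[of "-1"] that] by (simp add: single_uminus)
  show "\<And>p q. p \<in> C \<Longrightarrow> q \<in> C \<Longrightarrow> p - q \<in> C"
    using add neg by (metis diff_conv_add_uminus)
qed

lemma free_subalgebra_sum:
  assumes "free_subalgebra n C" "\<And>x. x \<in> X \<Longrightarrow> f x \<in> C"
  shows "sum f X \<in> C"
  using assms(2)
  by (induction X rule: infinite_finite_induct) (simp_all add: free_subalgebra_closed[OF assms(1)])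

lemma Qsubalgebra_preimage:
  fixes B :: "'k::field freealg set set"
  assumes "Qsubalgebra n B"
  shows "free_subalgebra n {p \<in> carrier (free_alg n). Qproj n p \<in> B}"
proof -
  interpret Q: ring "Qalg n :: 'k freealg set ring" by (rule ring_Qalg)
  have B: "subring B (Qalg n)" "subalgebra (range (Qscalar n)) B (Qalg n)"
    using assms by (simp_all add: Qsubalgebra_def)
  have "Qscalar n c \<in> B" for c
  proof -
    have "Qscalar n c \<otimes>\<^bsub>Qalg n\<^esub> \<one>\<^bsub>Qalg n\<^esub> \<in> B"
      using subalgebra.smult_closed[OF B(2)] subringE(3)[OF B(1)] by blast
    then show ?thesis
      by (simp add: Qscalar_def Qproj_closed scalar_in_free_alg)
  qed
  then show ?thesis
    using subringE(6,7)[OF B(1)]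
    by (simp add: free_subalgebra_def Qproj_simps free_alg_closed scalar_in_free_alg Qscalar_def)
qed

lemma Qsubalgebra_image:
  fixes C :: "'k::field freealg set"
  assumes C: "free_subalgebra n C"
  shows "Qsubalgebra n (Qproj n ` C)"
proof -
  interpret Q: ring "Qalg n :: 'k freealg set ring" by (rule ring_Qalg)
  have sub: "C \<subseteq> carrier (free_alg n)" using C by (simp add: free_subalgebra_def)
  then have car: "Qproj n ` C \<subseteq> carrier (Qalg n)" by (auto simp: carrier_Qalg)
  note cl = free_subalgebra_closed[OF C]
  have mult: "x \<otimes>\<^bsub>Qalg n\<^esub> y \<in> Qproj n ` C" if "x \<in> Qproj n ` C" "y \<in> Qproj n ` C" for x y
    using that cl(6) sub Qproj_simps(2)[where 'k = 'k] by (smt (verit) image_iff subset_iff)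
  have sr: "subring (Qproj n ` C) (Qalg n)"
  proof (rule Q.subringI[OF car])
    show "\<one>\<^bsub>Qalg n\<^esub> \<in> Qproj n ` C"
      using cl(1) Qproj_one[of n, where 'k = 'k] by (metis imageI)
    show "\<ominus>\<^bsub>Qalg n\<^esub> x \<in> Qproj n ` C" if "x \<in> Qproj n ` C" for x
      using that cl(3) sub Qproj_simps(3)[where 'k = 'k] by (smt (verit) image_iff subset_iff)
    show "x \<oplus>\<^bsub>Qalg n\<^esub> y \<in> Qproj n ` C" if "x \<in> Qproj n ` C" "y \<in> Qproj n ` C" for x y
      using that cl(5) sub Qproj_simps(1)[where 'k = 'k] by (smt (verit) image_iff subset_iff)
  qed (rule mult)
  moreover have "subalgebra (range (Qscalar n)) (Qproj n ` C) (Qalg n)"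
  proof (rule subalgebra.intro)
    show "subgroup (Qproj n ` C) (add_monoid (Qalg n))"
      using sr by (simp add: subring_def)
    show "subalgebra_axioms (range (Qscalar n)) (Qproj n ` C) (Qalg n)"
      using mult cl(7) unfolding subalgebra_axioms_def Qscalar_def by blast
  qed
  ultimately show ?thesis by (simp add: Qsubalgebra_def)
qed

lemma Qgenerated_induct: "f \<in> Qgenerated n X \<Longrightarrow> Qsubalgebra n B \<Longrightarrow> X \<subseteq> B \<Longrightarrow> f \<in> B"
  unfolding Qgenerated_def using hull_minimal by blast

lemma Qgenerated_I: "(\<And>B. Qsubalgebra n B \<Longrightarrow> X \<subseteq> B \<Longrightarrow> f \<in> B) \<Longrightarrow> f \<in> Qgenerated n X"
  unfolding Qgenerated_def hull_def by blast

lemma Qgenerated_subset: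
  assumes "X \<subseteq> Qgenerated n Y"
  shows "Qgenerated n X \<subseteq> Qgenerated n Y"
proof
  fix f assume f: "f \<in> Qgenerated n X"
  show "f \<in> Qgenerated n Y"
  proof (rule Qgenerated_I)
    fix B assume B: "Qsubalgebra n B" "Y \<subseteq> B"
    then have "X \<subseteq> B" using assms Qgenerated_induct by blast
    then show "f \<in> B" using f B Qgenerated_induct by blast
  qed
qed

lemma free_subalgebra_fsubst:
  assumes "\<And>x. x \<in> X \<Longrightarrow> g x \<in> carrier (free_alg n)"
  shows "free_subalgebra n (fsubst g ` polys_on X)"
  unfolding free_subalgebra_def
proof (intro conjI allI ballI)
  show "fsubst g ` polys_on X \<subseteq> carrier (free_alg n)"
    using assms by (auto simp: polys_on_def fsubst_def subset_iff
        intro!: sum_in_free_alg free_alg_closed scalar_in_free_alg prod_list_in_free_alg)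
  show "Poly_Mapping.single 0 c \<in> fsubst g ` polys_on X" for c
    by (rule image_eqI[where x = "Poly_Mapping.single 0 c"])
       (simp only: fsubst_scalar, simp add: polys_on_def zero_fmon_def)
  fix p q assume "p \<in> fsubst g ` polys_on X" "q \<in> fsubst g ` polys_on X"
  then obtain F G where F: "p = fsubst g F" "q = fsubst g G" "F \<in> polys_on X" "G \<in> polys_on X" by blast
  have "F + G \<in> polys_on X"
    using F(3,4) Poly_Mapping.keys_add[of F G] by (auto simp: polys_on_def)
  then show "p + q \<in> fsubst g ` polys_on X"
    unfolding F(1,2) fsubst_add[symmetric] by (rule imageI)
  have "F * G \<in> polys_on X"
    using F(3,4) keys_mult[of F G] by (fastforce simp: polys_on_def letters_plus)
  then show "p * q \<in> fsubst g ` polys_on X"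
    unfolding F(1,2) fsubst_mult[symmetric] by (rule imageI)
qed

section \<open>The flag of a permutation\<close>

text \<open>
  Lifts to the free algebra of the roots along the flag \<open>\<tau>{1} \<subset> \<tau>{1, 2} \<subset> \<dots>\<close>; for the
  identity these are the elements \<open>y\<^sub>j\<close>.
\<close>

definition flag_gen :: "(nat \<Rightarrow> nat) \<Rightarrow> nat \<Rightarrow> 'k::field freealg" where
  "flag_gen \<tau> j = free_gen (\<tau> ` {1..<j}) (\<tau> j)"

lemma flag_zgens:
  assumes "\<tau> permutes {1..n}" "j \<in> {1..n}"
  shows "(\<tau> ` {1..<j}, \<tau> j) \<in> zgens n"
  using assms by (intro zgens_act) (auto simp: zgens_def)

lemma flag_gen_in_free_alg: "\<tau> permutes {1..n} \<Longrightarrow> j \<in> {1..n} \<Longrightarrow> flag_gen \<tau> j \<in> carrier (free_alg n)"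
  unfolding flag_gen_def by (rule free_gen_in_free_alg[OF flag_zgens])

lemma r_flag:
  assumes \<tau>: "\<tau> permutes {1..n}"
  shows "m \<le> n \<Longrightarrow> r n (\<tau> ` {1..m}) = (Qproj n (\<Sum>j\<in>{1..m}. flag_gen \<tau> j) :: 'k::field freealg set)"
proof (induction m)
  case 0
  interpret Q: ring "Qalg n :: 'k freealg set ring" by (rule ring_Qalg)
  show ?case by (simp add: r_def r_list_def Qproj_zero)
next
  case (Suc m)
  interpret Q: ring "Qalg n :: 'k freealg set ring" by (rule ring_Qalg)
  have inj: "inj \<tau>" by (rule permutes_inj[OF \<tau>])
  have img: "\<tau> ` {1..n} = {1..n}" by (rule permutes_image[OF \<tau>])
  define cs where "cs = map \<tau> [1..<Suc m]"
  have cs: "set cs = \<tau> ` {1..m}" "distinct cs"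
    "distinct (cs @ [\<tau> (Suc m)])" "set (cs @ [\<tau> (Suc m)]) = \<tau> ` {1..Suc m}"
    using inj by (auto simp: cs_def distinct_map inj_eq intro: inj_on_subset)
  have sub: "\<tau> ` {1..Suc m} \<subseteq> {1..n}" "\<tau> ` {1..m} \<subseteq> {1..n}"
    using Suc.prems img by (auto simp: image_subset_iff intro!: imageI)
  have car: "flag_gen \<tau> j \<in> carrier (free_alg n :: 'k freealg ring)" if "j \<in> {1..Suc m}" for j
    using that Suc.prems by (intro flag_gen_in_free_alg[OF \<tau>]) auto
  have "r n (\<tau> ` {1..Suc m}) = (zel n (\<tau> ` {1..m}) (\<tau> (Suc m)) \<oplus>\<^bsub>Qalg n\<^esub> r n (\<tau> ` {1..m}) :: 'k freealg set)"
    using r_list_snoc[OF cs(3), of n, where 'k = 'k] r_list_eq_r[OF cs(3), of n, where 'a = 'k]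
      r_list_eq_r[OF cs(2), of n, where 'a = 'k] sub unfolding cs(1,4) by simp
  also have "zel n (\<tau> ` {1..m}) (\<tau> (Suc m)) = (Qproj n (flag_gen \<tau> (Suc m)) :: 'k freealg set)"
    by (simp add: zel_def flag_gen_def atLeastLessThanSuc_atLeastAtMost)
  also have "r n (\<tau> ` {1..m}) = (Qproj n (\<Sum>j\<in>{1..m}. flag_gen \<tau> j) :: 'k freealg set)"
    using Suc by simp
  also have "Qproj n (flag_gen \<tau> (Suc m)) \<oplus>\<^bsub>Qalg n\<^esub> Qproj n (\<Sum>j\<in>{1..m}. flag_gen \<tau> j) =
      (Qproj n (flag_gen \<tau> (Suc m) + (\<Sum>j\<in>{1..m}. flag_gen \<tau> j)) :: 'k freealg set)"
    using car by (intro Qproj_simps(1)[symmetric] sum_in_free_alg) auto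
  also have "flag_gen \<tau> (Suc m) + (\<Sum>j\<in>{1..m}. flag_gen \<tau> j) = (\<Sum>j\<in>{1..Suc m}. flag_gen \<tau> j :: 'k freealg)"
    by (simp add: add.commute)
  finally show ?case .
qed

lemma flag_gen_in_subalgebra:
  fixes B :: "'k::field freealg set set"
  assumes \<tau>: "\<tau> permutes {1..n}" and B: "Qsubalgebra n B"
    and gen: "{r n (\<tau> ` {1..m}) | m. m \<in> {1..n}} \<subseteq> B" and j: "j \<in> {1..n}"
  shows "Qproj n (flag_gen \<tau> j) \<in> B"
proof -
  define C where "C = {p \<in> carrier (free_alg n). Qproj n p \<in> B}"
  have C: "free_subalgebra n C" unfolding C_def by (rule Qsubalgebra_preimage[OF B])
  have mem: "(\<Sum>i\<in>{1..m}. flag_gen \<tau> i) \<in> C" if "m \<le> n" for m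
  proof (cases "m = 0")
    case True
    then show ?thesis using free_subalgebra_closed(2)[OF C] by simp
  next
    case False
    then have "r n (\<tau> ` {1..m}) \<in> B" using gen that by (auto simp: Suc_le_eq)
    moreover have "(\<Sum>i\<in>{1..m}. flag_gen \<tau> i) \<in> carrier (free_alg n :: 'k freealg ring)"
      using that by (intro sum_in_free_alg flag_gen_in_free_alg[OF \<tau>]) auto
    ultimately show ?thesis unfolding C_def r_flag[OF \<tau> that] by (simp only: mem_Collect_eq simp_thms)
  qed
  obtain k where k: "j = Suc k" using j by (cases j) auto
  have "flag_gen \<tau> j = (\<Sum>i\<in>{1..j}. flag_gen \<tau> i) - (\<Sum>i\<in>{1..k}. flag_gen \<tau> i :: 'k freealg)"
    by (simp add: k)
  also have "\<dots> \<in> C"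
    using mem[of j] mem[of k] j k by (intro free_subalgebra_closed(4)[OF C]) auto
  finally show ?thesis by (simp add: C_def)
qed

lemma word_in_polys_on: "set w \<subseteq> X \<Longrightarrow> word w \<in> polys_on X"
  by (simp add: polys_on_def word_def)

lemma Qsub_obtain_poly:
  assumes \<tau>: "\<tau> permutes {1..n}" and f: "f \<in> Qsub n \<tau>"
  obtains F where "F \<in> polys_on {1..n}" "f = (Qproj n (fsubst (flag_gen \<tau>) F) :: 'k::field freealg set)"
proof -
  define C where "C = fsubst (flag_gen \<tau>) ` (polys_on {1..n} :: (nat fmon \<Rightarrow>\<^sub>0 'k) set)"
  have C: "free_subalgebra n C"
    unfolding C_def by (rule free_subalgebra_fsubst) (rule flag_gen_in_free_alg[OF \<tau>])
  have "r n (\<tau> ` {1..m}) \<in> Qproj n ` C" if "m \<in> {1..n}" for m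
  proof -
    have "flag_gen \<tau> j \<in> C" if "j \<in> {1..m}" for j
      using that \<open>m \<in> {1..n}\<close> word_in_polys_on[of "[j]" "{1..n}"]
      unfolding C_def by (intro image_eqI[of _ _ "word [j]"]) (auto simp: fsubst_word)
    then have "(\<Sum>j\<in>{1..m}. flag_gen \<tau> j) \<in> C" by (rule free_subalgebra_sum[OF C])
    then show ?thesis using r_flag[OF \<tau>, of m, where 'k = 'k] that by auto
  qed
  then have "f \<in> Qproj n ` C"
    using f Qgenerated_induct[OF _ Qsubalgebra_image[OF C]] unfolding Qsub_def by blast
  then show thesis using that by (auto simp: C_def)
qed

text \<open>
  Both homomorphisms take the same values on the roots of the flag of \<open>\<tau>\<close>, since that flag does not
  pass through \<open>{1..i}\<close>; on the standard flag, which does, they give the two twisted letters.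
\<close>

lemma twist_eq_if_missed:
  fixes F G :: "nat fmon \<Rightarrow>\<^sub>0 'k::field"
  assumes \<tau>: "\<tau> permutes {1..n}" and F: "F \<in> polys_on {1..n}" and G: "G \<in> polys_on {1..n}"
    and eq: "Qproj n (fsubst (flag_gen id) F) = Qproj n (fsubst (flag_gen \<tau>) G)"
    and missed: "\<tau> ` {1..i} \<noteq> {1..i}"
  shows "fsubst (twist i i) F = fsubst (twist i (Suc i)) F"
proof -
  have inj: "inj \<tau>" by (rule permutes_inj[OF \<tau>])
  have car: "fsubst (flag_gen \<sigma>) P \<in> carrier (free_alg n)"
    if "\<sigma> permutes {1..n}" "P \<in> polys_on {1..n}" for \<sigma> and P :: "nat fmon \<Rightarrow>\<^sub>0 'k"
    using free_subalgebra_fsubst[of "{1..n}" "flag_gen \<sigma>" n, OF flag_gen_in_free_alg[OF that(1)]] that(2)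
    by (auto simp: free_subalgebra_def)
  have diff: "fsubst (flag_gen id) F - fsubst (flag_gen \<tau>) G \<in> Qideal n"
    using eq Qproj_eq_iff[OF car[OF permutes_id F] car[OF \<tau> G]] by simp
  have letter: "x \<in> {1..n}" if "P \<in> polys_on {1..n}" "w \<in> Poly_Mapping.keys P" "x \<in> set (letters w)"
    for P :: "nat fmon \<Rightarrow>\<^sub>0 'k" and w x
    using that unfolding polys_on_def by blast
  have "fsubst (twist i i) F = fsubst (bent i) (fsubst (flag_gen id) F)"
    unfolding fsubst_fsubst
  proof (rule fsubst_cong)
    fix w x assume "w \<in> Poly_Mapping.keys F" "x \<in> set (letters w)"
    then have x: "1 \<le> x" using letter[OF F] by simp
    then have "insert x {1..<x} = {1..x}" by auto
    moreover have "twist i i x = (twist i (Suc i) x :: nat fmon \<Rightarrow>\<^sub>0 'k)" if "x \<noteq> i" "x \<noteq> Suc i"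
      using that by (simp add: twist_def)
    moreover have "{1..<Suc i} = {1..i}" by auto
    ultimately show "twist i i x = (fsubst (bent i) (flag_gen id x) :: nat fmon \<Rightarrow>\<^sub>0 'k)"
      using x by (cases "x = i \<or> x = Suc i") (auto simp: flag_gen_def fsubst_free_gen bent_def)
  qed
  also have "\<dots> = fsubst (bent i) (fsubst (flag_gen \<tau>) G)"
    using fsubst_Qideal[where g = "bent i", OF bent_relator diff] by (simp add: fsubst_diff)
  also have "\<dots> = fsubst (flat (twist i (Suc i))) (fsubst (flag_gen \<tau>) G)"
    unfolding fsubst_fsubst
  proof (rule fsubst_cong)
    fix w x assume "w \<in> Poly_Mapping.keys G" "x \<in> set (letters w)"
    then have x: "1 \<le> x" using letter[OF G] by simp
    have card: "card (\<tau> ` A) = card A" for A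
      using inj by (intro card_image) (auto intro: inj_on_subset)
    have 1: "\<tau> ` {1..<x} \<noteq> {1..i}"
    proof
      assume "\<tau> ` {1..<x} = {1..i}"
      moreover from this have "x - 1 = i" using card[of "{1..<x}"] by simp
      then have "{1..<x} = {1..i}" using x by auto
      ultimately show False using missed by simp
    qed
    have 2: "insert (\<tau> x) (\<tau> ` {1..<x}) \<noteq> {1..i}"
    proof
      assume *: "insert (\<tau> x) (\<tau> ` {1..<x}) = {1..i}"
      have "insert (\<tau> x) (\<tau> ` {1..<x}) = \<tau> ` {1..x}" using x by (auto simp: image_iff le_less)
      with * have "\<tau> ` {1..x} = {1..i}" by simp
      moreover from this have "x = i" using card[of "{1..x}"] by simp
      ultimately show False using missed by simp
    qed
    show "fsubst (bent i) (flag_gen \<tau> x) = (fsubst (flat (twist i (Suc i))) (flag_gen \<tau> x) :: nat fmon \<Rightarrow>\<^sub>0 'k)"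
      using 1 2 by (simp add: flag_gen_def fsubst_free_gen bent_def flat_def)
  qed
  also have "\<dots> = fsubst (flat (twist i (Suc i))) (fsubst (flag_gen id) F)"
    using fsubst_Qideal[where g = "flat (twist i (Suc i))", OF flat_relator diff] by (simp add: fsubst_diff)
  also have "\<dots> = fsubst (twist i (Suc i)) F"
    unfolding fsubst_fsubst
  proof (rule fsubst_cong)
    fix w x assume "w \<in> Poly_Mapping.keys F" "x \<in> set (letters w)"
    then have "1 \<le> x" using letter[OF F] by simp
    then show "fsubst (flat (twist i (Suc i))) (flag_gen id x) = (twist i (Suc i) x :: nat fmon \<Rightarrow>\<^sub>0 'k)"
      by (simp add: flag_gen_def fsubst_free_gen flat_def)
  qed
  finally show ?thesis .
qed

section \<open>Elementary symmetric functions along a path\<close>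

text \<open>
  The elementary symmetric functions of the roots along the path that starts at \<open>A\<close> and adds the
  elements of the list from its last to its first. Later roots stand further left in every product,
  as in \<open>\<Lambda>\<^sub>m\<close>.
\<close>

fun path_sym :: "nat set \<Rightarrow> nat list \<Rightarrow> nat \<Rightarrow> 'k::field freealg" where
  "path_sym A cs 0 = 1"
| "path_sym A [] (Suc m) = 0"
| "path_sym A (c # cs) (Suc m) = free_gen (A \<union> set cs) c * path_sym A cs m + path_sym A cs (Suc m)"

definition path_in :: "nat \<Rightarrow> nat set \<Rightarrow> nat list \<Rightarrow> bool" where
  "path_in n A cs \<longleftrightarrow> distinct cs \<and> A \<inter> set cs = {} \<and> A \<union> set cs \<subseteq> {1..n}"

lemma path_in_ConsD:
  "path_in n A (c # cs) \<Longrightarrow> path_in n A cs"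
  "path_in n A (c # cs) \<Longrightarrow> (A \<union> set cs, c) \<in> zgens n"
  by (auto simp: path_in_def zgens_def)

lemma path_sym_in_subalgebra:
  assumes C: "free_subalgebra n C"
    and "\<And>c ds cs'. cs = cs' @ c # ds \<Longrightarrow> free_gen (A \<union> set ds) c \<in> C"
  shows "path_sym A cs m \<in> C"
  using assms(2)
proof (induction A cs m rule: path_sym.induct)
  case (3 A c cs m)
  have "path_sym A cs m \<in> C" "path_sym A cs (Suc m) \<in> C"
    using 3 by (metis append_Cons)+
  moreover have "free_gen (A \<union> set cs) c \<in> C" using 3(3)[of "[]" c cs] by simp
  ultimately show ?case by (simp add: free_subalgebra_closed[OF C])
qed (simp_all add: free_subalgebra_closed[OF C])

lemma path_sym_in_free_alg:
  assumes "path_in n A cs"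
  shows "path_sym A cs m \<in> carrier (free_alg n :: 'k::field freealg ring)"
proof (rule path_sym_in_subalgebra)
  show "free_subalgebra n (carrier (free_alg n :: 'k freealg ring))"
    by (simp add: free_subalgebra_def scalar_in_free_alg free_alg_closed)
  show "free_gen (A \<union> set ds) c \<in> carrier (free_alg n)" if "cs = cs' @ c # ds" for c ds cs'
    using assms that by (intro free_gen_in_free_alg) (auto simp: path_in_def zgens_def)
qed

lemma Qideal_closed:
  fixes p q :: "'k::field freealg"
  shows "p \<in> Qideal n \<Longrightarrow> q \<in> Qideal n \<Longrightarrow> p + q \<in> Qideal n"
    and "0 \<in> (Qideal n :: 'k freealg set)"
    and "p \<in> Qideal n \<Longrightarrow> q \<in> carrier (free_alg n) \<Longrightarrow> p * q \<in> Qideal n"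
    and "p \<in> Qideal n \<Longrightarrow> q \<in> carrier (free_alg n) \<Longrightarrow> q * p \<in> Qideal n"
proof -
  interpret I: ideal "Qideal n" "free_alg n :: 'k freealg ring" by (rule ideal_Qideal)
  show "p \<in> Qideal n \<Longrightarrow> q \<in> Qideal n \<Longrightarrow> p + q \<in> Qideal n" "0 \<in> (Qideal n :: 'k freealg set)"
    "p \<in> Qideal n \<Longrightarrow> q \<in> carrier (free_alg n) \<Longrightarrow> p * q \<in> Qideal n"
    "p \<in> Qideal n \<Longrightarrow> q \<in> carrier (free_alg n) \<Longrightarrow> q * p \<in> Qideal n"
    using additive_subgroup.a_closed[OF I.additive_subgroup_axioms, of p q]
      additive_subgroup.zero_closed[OF I.additive_subgroup_axioms] I.I_r_closed[of p q] I.I_l_closed[of p q] by simp_all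
qed

lemma relators_in_Qideal:
  assumes "A \<subseteq> {1..n}" "i \<in> {1..n} - A" "j \<in> {1..n} - A" "i \<noteq> j"
  shows "(free_gen (A \<union> {i}) j + free_gen A i) - (free_gen (A \<union> {j}) i + free_gen A j) \<in> (Qideal n :: 'k::field freealg set)"
    and "free_gen (A \<union> {i}) j * free_gen A i - free_gen (A \<union> {j}) i * free_gen A j \<in> (Qideal n :: 'k freealg set)"
  by (rule subsetD[OF relators_subset_Qideal]; use assms in \<open>unfold relators_def, blast\<close>)+

text \<open>
  If \<open>e\<^sub>k\<close> are the elementary functions of the remaining path, the difference is the difference of
  the two products times \<open>e\<^bsub>m-2\<^esub>\<close> plus the difference of the two sums times \<open>e\<^bsub>m-1\<^esub>\<close>,
  and both differences are relators.
\<close>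

lemma path_sym_swap:
  assumes p: "path_in n A (a # c # zs)"
  shows "path_sym A (a # c # zs) m - path_sym A (c # a # zs) m \<in> (Qideal n :: 'k::field freealg set)"
proof -
  let ?B = "A \<union> set zs"
  have B: "?B \<subseteq> {1..n}" "c \<in> {1..n} - ?B" "a \<in> {1..n} - ?B" "c \<noteq> a"
    using p by (auto simp: path_in_def)
  note rel = relators_in_Qideal[OF B, where 'k = 'k]
  have ins: "A \<union> set (c # zs) = ?B \<union> {c}" "A \<union> set (a # zs) = ?B \<union> {a}" by auto
  have z: "path_sym A zs k \<in> carrier (free_alg n :: 'k freealg ring)" for k
    using p by (intro path_sym_in_free_alg) (auto simp: path_in_def)
  consider "m = 0" | "m = Suc 0" | k where "m = Suc (Suc k)"
    by (metis not0_implies_Suc)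
  then show ?thesis
  proof cases
    case 1
    then show ?thesis by (simp add: Qideal_closed)
  next
    case 2
    have "path_sym A (a # c # zs) m - path_sym A (c # a # zs) m =
      (free_gen (?B \<union> {c}) a + free_gen ?B c) - (free_gen (?B \<union> {a}) c + free_gen ?B a :: 'k freealg)"
      unfolding 2 by (simp only: path_sym.simps ins) (simp add: algebra_simps)
    then show ?thesis using rel by simp
  next
    case 3
    have "path_sym A (a # c # zs) m - path_sym A (c # a # zs) m =
      (free_gen (?B \<union> {c}) a * free_gen ?B c - free_gen (?B \<union> {a}) c * free_gen ?B a) * path_sym A zs k +
      ((free_gen (?B \<union> {c}) a + free_gen ?B c) - (free_gen (?B \<union> {a}) c + free_gen ?B a)) * (path_sym A zs (Suc k) :: 'k freealg)"
      unfolding 3 by (simp only: path_sym.simps ins) (simp add: algebra_simps)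
    then show ?thesis using rel z by (simp only:) (intro Qideal_closed)
  qed
qed

text \<open>
  Two orderings with the same last step are compared by induction, and two with different last steps
  by passing through orderings whose last two steps can be exchanged.
\<close>

lemma path_sym_independent:
  assumes "path_in n A xs" "path_in n A ys" "set xs = set ys"
  shows "path_sym A xs m - path_sym A ys m \<in> (Qideal n :: 'k::field freealg set)"
  using assms
proof (induction "length xs" arbitrary: xs ys m rule: less_induct)
  case less
  have trans: "p - t \<in> Qideal n" if "p - q \<in> Qideal n" "q - t \<in> Qideal n" for p q t :: "'k freealg"
    using Qideal_closed(1)[OF that] by simp
  have Cons: "path_sym A (a # us) m - path_sym A (a # vs) m \<in> (Qideal n :: 'k freealg set)"
    if "path_in n A (a # us)" "path_in n A (a # vs)" "set us = set vs" "length us < length xs" for a us vs m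
  proof (cases m)
    case 0
    then show ?thesis by (simp add: Qideal_closed)
  next
    case (Suc k)
    have IH: "path_sym A us l - path_sym A vs l \<in> (Qideal n :: 'k freealg set)" for l
      by (rule less.hyps[OF that(4)]) (use that path_in_ConsD in blast)+
    have "path_sym A (a # us) m - path_sym A (a # vs) m =
      free_gen (A \<union> set vs) a * (path_sym A us k - path_sym A vs k) + (path_sym A us (Suc k) - path_sym A vs (Suc k) :: 'k freealg)"
      by (simp add: Suc that(3) algebra_simps)
    then show ?thesis
      using IH free_gen_in_free_alg[OF path_in_ConsD(2)[OF that(2)]]
      by (simp only:) (intro Qideal_closed)
  qed
  show ?case
  proof (cases xs)
    case Nil
    then show ?thesis using less.prems by (simp add: Qideal_closed)
  next
    case xs: (Cons a xs')
    obtain c ys' where ys: "ys = c # ys'" using less.prems(3) xs by (cases ys) auto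
    have len: "length ys = length xs"
      using less.prems distinct_card[of xs] distinct_card[of ys] by (simp add: path_in_def)
    show ?thesis
    proof (cases "a = c")
      case True
      have "set xs' = set ys'" using less.prems xs ys True by (auto simp: path_in_def)
      then show ?thesis using Cons[of a xs' ys'] less.prems xs ys True by simp
    next
      case False
      obtain zs where zs: "set zs = set xs - {a, c}" "distinct zs"
        using finite_distinct_list[of "set xs - {a, c}"] by auto
      have sets: "set xs' = set (c # zs)" "set ys' = set (a # zs)"
        using less.prems xs ys zs False by (auto simp: path_in_def)
      have p: "path_in n A (a # c # zs)" "path_in n A (c # a # zs)"
        using less.prems xs ys zs False by (auto simp: path_in_def)
      have "path_sym A xs m - path_sym A (a # c # zs) m \<in> (Qideal n :: 'k freealg set)"
        unfolding xs by (rule Cons) (use less.prems xs p sets in auto)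
      moreover have "path_sym A (c # a # zs) m - path_sym A ys m \<in> (Qideal n :: 'k freealg set)"
      proof -
        have "length (a # zs) < length xs"
          using distinct_card[of "a # zs"] distinct_card[of ys'] sets(2) less.prems ys len p(2)
          by (simp add: path_in_def)
        then show ?thesis unfolding ys by (intro Cons) (use less.prems ys p sets in auto)
      qed
      ultimately show ?thesis using path_sym_swap[OF p(1), of m, where 'k = 'k] trans by blast
    qed
  qed
qed

lemma free_act_path_sym:
  "inj \<sigma> \<Longrightarrow> free_act \<sigma> (path_sym A cs m) = path_sym (\<sigma> ` A) (map \<sigma> cs) m"
proof (induction A cs m rule: path_sym.induct)
  case (1 A cs)
  show ?case using free_act_single[of \<sigma> 0 1] by (simp add: map_fmon_zero)
qed (simp_all add: free_act_add free_act_mult free_act_gen image_Un)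

lemma decreasing_lists_0: "decreasing_lists 0 I = {[]}"
  by (auto simp: decreasing_lists_def)

lemma decreasing_lists_Suc_empty: "decreasing_lists (Suc m) {} = {}"
  by (auto simp: decreasing_lists_def)

lemma decreasing_lists_Suc_insert:
  assumes "\<forall>x\<in>I. x < k"
  shows "decreasing_lists (Suc m) (insert k I) = decreasing_lists (Suc m) I \<union> (#) k ` decreasing_lists m I"
proof (intro Set.set_eqI iffI)
  fix xs assume "xs \<in> decreasing_lists (Suc m) (insert k I)"
  then obtain x ys where xs: "xs = x # ys" "length ys = m" "\<forall>y\<in>set ys. y < x" "sorted_wrt (>) ys"
    "x \<in> insert k I" "set ys \<subseteq> insert k I"
    by (cases xs) (auto simp: decreasing_lists_def)
  then have "k \<notin> set ys" using assms by fastforce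
  then show "xs \<in> decreasing_lists (Suc m) I \<union> (#) k ` decreasing_lists m I"
    using xs by (cases "x = k") (auto simp: decreasing_lists_def)
next
  fix xs assume "xs \<in> decreasing_lists (Suc m) I \<union> (#) k ` decreasing_lists m I"
  then show "xs \<in> decreasing_lists (Suc m) (insert k I)"
    using assms by (fastforce simp: decreasing_lists_def)
qed

lemma elem_sym_insert:
  assumes "finite I" "\<forall>x\<in>I. x < k"
  shows "elem_sym (Suc m) (insert k I) = word [k] * elem_sym m I + (elem_sym (Suc m) I :: nat fmon \<Rightarrow>\<^sub>0 'k::field)"
proof -
  have "k \<notin> I" using assms(2) by auto
  then have disj: "decreasing_lists (Suc m) I \<inter> (#) k ` decreasing_lists m I = {}"
    by (auto simp: decreasing_lists_def)
  have "elem_sym (Suc m) (insert k I) =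
      elem_sym (Suc m) I + (\<Sum>xs\<in>(#) k ` decreasing_lists m I. word xs :: nat fmon \<Rightarrow>\<^sub>0 'k)"
    unfolding elem_sym_def decreasing_lists_Suc_insert[OF assms(2)]
    by (rule sum.union_disjoint) (use assms disj in \<open>auto simp: finite_decreasing_lists\<close>)
  also have "(\<Sum>xs\<in>(#) k ` decreasing_lists m I. word xs :: nat fmon \<Rightarrow>\<^sub>0 'k) = word [k] * elem_sym m I"
    by (simp add: sum.reindex elem_sym_def sum_distrib_left flip: word_append)
  finally show ?thesis by (simp add: add.commute)
qed

lemma fsubst_flag_elem_sym:
  assumes "1 \<le> a" "a \<le> k"
  shows "fsubst (flag_gen id) (elem_sym m {a..<k}) = path_sym {1..<a} (rev [a..<k]) m"
  using assms(2)
proof (induction k arbitrary: m rule: dec_induct)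
  case base
  show ?case
    by (cases m) (simp_all add: elem_sym_def decreasing_lists_0 decreasing_lists_Suc_empty word_Nil)
next
  case (step k)
  show ?case
  proof (cases m)
    case 0
    then show ?thesis by (simp add: elem_sym_def decreasing_lists_0 word_Nil)
  next
    case (Suc l)
    have "{a..<Suc k} = insert k {a..<k}" "{1..<a} \<union> {a..<k} = {1..<k}"
      using step assms by auto
    then show ?thesis
      using step Suc by (simp add: elem_sym_insert fsubst_add fsubst_mult fsubst_word flag_gen_def)
  qed
qed

lemma Lambda_eq_Qproj:
  assumes "I \<subseteq> {1..n}"
  shows "Lambda n m I = (Qproj n (fsubst (flag_gen id) (elem_sym m I)) :: 'k::field freealg set)"
proof -
  interpret Q: ring "Qalg n :: 'k freealg set ring" by (rule ring_Qalg)
  have y: "yel n = (\<lambda>x. Qproj n (flag_gen id x) :: 'k freealg set)"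
    by (simp add: fun_eq_iff yel_def zel_def flag_gen_def)
  have car: "prod_list (map (flag_gen id) xs) \<in> carrier (free_alg n :: 'k freealg ring)"
    if "xs \<in> decreasing_lists m I" for xs
    using that assms
    by (intro prod_list_in_free_alg) (auto simp: decreasing_lists_def intro!: flag_gen_in_free_alg permutes_id)
  have prods: "foldr (\<otimes>\<^bsub>Qalg n\<^esub>) (map (yel n) xs) \<one>\<^bsub>Qalg n\<^esub> =
      (Qproj n (prod_list (map (flag_gen id) xs)) :: 'k freealg set)" if "xs \<in> decreasing_lists m I" for xs
  proof -
    have "\<And>p. p \<in> set (map (flag_gen id) xs) \<Longrightarrow> p \<in> carrier (free_alg n :: 'k freealg ring)"
      using that assms by (auto simp: decreasing_lists_def intro!: flag_gen_in_free_alg permutes_id)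
    from Qproj_prod_list[of "map (flag_gen id) xs" n, OF this] show ?thesis by (simp add: y o_def)
  qed
  have fin: "finite (decreasing_lists m I)"
    using assms finite_subset by (intro finite_decreasing_lists) blast
  have "Lambda n m I = (\<Oplus>\<^bsub>Qalg n\<^esub>xs\<in>decreasing_lists m I. Qproj n (prod_list (map (flag_gen id) xs)) :: 'k freealg set)"
    unfolding Lambda_def decreasing_lists_def[symmetric]
    by (rule Q.finsum_cong') (auto simp: prods car Qproj_closed)
  also have "\<dots> = Qproj n (\<Sum>xs\<in>decreasing_lists m I. prod_list (map (flag_gen id) xs))"
    by (rule Qproj_sum[symmetric, OF fin car])
  finally show ?thesis by (simp add: elem_sym_def fsubst_sum fsubst_word)
qed

lemma Lambda_eq_path:
  assumes "1 \<le> a" "a \<le> k" "k \<le> Suc n"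
  shows "Lambda n m {a..<k} = (Qproj n (path_sym {1..<a} (rev [a..<k]) m) :: 'k::field freealg set)"
  using assms by (subst Lambda_eq_Qproj) (auto simp: fsubst_flag_elem_sym[OF assms(1,2)])

lemma Lambda_invariant:
  fixes n :: nat
  assumes \<tau>: "\<tau> permutes {1..n}" and k: "1 \<le> a" "a \<le> k" "k \<le> Suc n"
    and inv: "\<tau> ` {1..<a} = {1..<a}" "\<tau> ` {a..<k} = {a..<k}"
  shows "Qact \<tau> (Lambda n m {a..<k}) = (Lambda n m {a..<k} :: 'k::field freealg set)"
    and "Lambda n m {a..<k} = (Qproj n (path_sym (\<tau> ` {1..<a}) (map \<tau> (rev [a..<k])) m) :: 'k freealg set)"
proof -
  have inj: "inj \<tau>" by (rule permutes_inj[OF \<tau>])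
  have p1: "path_in n {1..<a} (rev [a..<k])" using k by (auto simp: path_in_def)
  have p2: "path_in n {1..<a} (map \<tau> (rev [a..<k]))"
    using k inj inv by (auto simp: path_in_def distinct_map intro: inj_on_subset)
  have "path_sym {1..<a} (map \<tau> (rev [a..<k])) m - path_sym {1..<a} (rev [a..<k]) m \<in> (Qideal n :: 'k freealg set)"
    by (rule path_sym_independent[OF p2 p1]) (simp add: inv)
  then have eq: "Qproj n (path_sym {1..<a} (map \<tau> (rev [a..<k])) m) = (Lambda n m {a..<k} :: 'k freealg set)"
    unfolding Lambda_eq_path[OF k]
    using Qproj_eq_iff[OF path_sym_in_free_alg[OF p2, where 'k = 'k] path_sym_in_free_alg[OF p1, where 'k = 'k]] by blast
  then show "Lambda n m {a..<k} = (Qproj n (path_sym (\<tau> ` {1..<a}) (map \<tau> (rev [a..<k])) m) :: 'k freealg set)"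
    by (simp only: inv)
  show "Qact \<tau> (Lambda n m {a..<k}) = (Lambda n m {a..<k} :: 'k freealg set)"
    unfolding Lambda_eq_path[OF k] Qact_Qproj[OF \<tau>] free_act_path_sym[OF inj] inv
    using eq by (simp only: Lambda_eq_path[OF k])
qed

text \<open>
  Transporting the standard path of the block by \<open>\<tau>\<close> does not change \<open>\<Lambda>\<^sub>m\<close>, and turns its roots
  into roots along the flag of \<open>\<tau>\<close>.
\<close>

lemma Lambda_in_Qsub:
  fixes n :: nat
  assumes \<tau>: "\<tau> permutes {1..n}" and k: "1 \<le> a" "a \<le> k" "k \<le> Suc n"
    and inv: "\<tau> ` {1..<a} = {1..<a}" "\<tau> ` {a..<k} = {a..<k}"
  shows "Lambda n m {a..<k} \<in> (Qsub n \<tau> :: 'k::field freealg set set)"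
  unfolding Qsub_def
proof (rule Qgenerated_I)
  fix B :: "'k freealg set set"
  assume B: "Qsubalgebra n B" and gen: "{r n (\<tau> ` {1..m}) | m. m \<in> {1..n}} \<subseteq> B"
  define C where "C = {p \<in> carrier (free_alg n). Qproj n p \<in> B}"
  have C: "free_subalgebra n C" unfolding C_def by (rule Qsubalgebra_preimage[OF B])
  have "path_sym (\<tau> ` {1..<a}) (map \<tau> (rev [a..<k])) m \<in> C"
  proof (rule path_sym_in_subalgebra[OF C])
    fix c ds cs' assume "map \<tau> (rev [a..<k]) = cs' @ c # ds"
    then obtain us j vs where d: "rev [a..<k] = us @ j # vs" "c = \<tau> j" "ds = map \<tau> vs"
      by (auto simp: map_eq_append_conv map_eq_Cons_conv append_eq_map_conv Cons_eq_map_conv)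
    \<comment> \<open>The elements below \<open>j\<close> in the path are those of \<open>{a..<j}\<close>, so its root is the one of the flag.\<close>
    have up: "[a..<k] = rev vs @ j # rev us"
      using d(1) by (metis append.assoc append_Cons append_Nil rev_append rev_rev_ident rev.simps(2))
    define l where "l = length vs"
    have l: "l < k - a" using arg_cong[OF up, of length] by (simp add: l_def)
    have "[a..<k] ! l = j" using up by (simp add: l_def nth_append)
    then have j: "j = a + l" using l by simp
    have "rev vs = take l [a..<k]" using up by (simp add: l_def)
    also have "\<dots> = [a..<j]" using l j by simp
    finally have "rev vs = [a..<j]" .
    then have "set vs = {a..<j}" by (metis set_rev set_upt)
    then have "\<tau> ` {1..<a} \<union> set ds = \<tau> ` {1..<j}"
      using d(3) j k by (simp add: ivl_disj_un flip: image_Un)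
    then have "free_gen (\<tau> ` {1..<a} \<union> set ds) c = (flag_gen \<tau> j :: 'k freealg)"
      by (simp add: flag_gen_def d)
    then show "free_gen (\<tau> ` {1..<a} \<union> set ds) c \<in> C"
      using flag_gen_in_subalgebra[OF \<tau> B gen, of j] flag_gen_in_free_alg[OF \<tau>, of j, where 'a = 'k] j k l
      by (simp add: C_def)
  qed
  then show "Lambda n m {a..<k} \<in> B"
    using Lambda_invariant(2)[OF assms, of m, where 'k = 'k] by (simp add: C_def)
qed

section \<open>Blocks and the intersection\<close>

lemma (in linorder) sorted_key_list_of_set_enumerates:
  assumes "finite A" "inj_on f A"
  shows "set (sorted_key_list_of_set f A) = A" "length (sorted_key_list_of_set f A) = card A"
proof -
  interpret folding_insort_key "(\<le>)" "(<)" A f by unfold_locales (rule assms(2))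
  show "set (sorted_key_list_of_set f A) = A" "length (sorted_key_list_of_set f A) = card A"
    using assms(1) by simp_all
qed

locale permutation_set =
  fixes n :: nat and S :: "(nat \<Rightarrow> nat) set"
  assumes n: "n \<ge> 1" and S: "S \<subseteq> {\<sigma>. \<sigma> permutes {1..n}}"
begin

lemma blocks_partition: "partition_on {1..n} (blocks n S)"
  and blocks_invariant: "I \<in> blocks n S \<Longrightarrow> invariant_interval S I"
  and blocks_finest: "invariant_interval_partition n S P \<Longrightarrow> refines {1..n} (blocks n S) P"
proof -
  have "invariant_interval_partition n S (blocks n S) \<and>
      (\<forall>P. invariant_interval_partition n S P \<longrightarrow> refines {1..n} (blocks n S) P)"
    unfolding blocks_def by (rule theI'[OF ex1_finest_partition[OF n S]])
  then show "partition_on {1..n} (blocks n S)" "I \<in> blocks n S \<Longrightarrow> invariant_interval S I"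
    "invariant_interval_partition n S P \<Longrightarrow> refines {1..n} (blocks n S) P"
    unfolding invariant_interval_partition_def by blast+
qed

lemma block_obtain_bounds:
  assumes "I \<in> blocks n S"
  obtains a k where "I = {a..<k}" "1 \<le> a" "a < k" "k \<le> Suc n"
proof -
  obtain a c where ac: "I = {a..c}" using blocks_invariant[OF assms] by (auto simp: invariant_interval_def)
  have "I \<noteq> {}" "I \<subseteq> {1..n}" using blocks_partition assms by (auto simp: partition_on_def)
  then have "I = {a..<Suc c}" "1 \<le> a" "a < Suc c" "Suc c \<le> Suc n" using ac by auto
  then show thesis by (rule that)
qed

lemma block_unique: "I \<in> blocks n S \<Longrightarrow> J \<in> blocks n S \<Longrightarrow> x \<in> I \<Longrightarrow> x \<in> J \<Longrightarrow> I = J"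
  using blocks_partition unfolding partition_on_def disjoint_def by blast

lemma block_ex: "x \<in> {1..n} \<Longrightarrow> \<exists>I\<in>blocks n S. x \<in> I"
  using blocks_partition by (auto simp: partition_on_def)

lemma block_image: "block n S ` {1..num_blocks n S} = blocks n S"
proof -
  have fin: "finite (blocks n S)"
    using blocks_partition finite_elements by blast
  have inj: "inj_on Min (blocks n S)"
  proof (rule inj_onI)
    fix I J assume IJ: "I \<in> blocks n S" "J \<in> blocks n S" "Min I = Min J"
    have "Min I \<in> I" if "I \<in> blocks n S" for I
      by (rule block_obtain_bounds[OF that]) (auto intro!: Min_in)
    then show "I = J" using IJ block_unique by metis
  qed
  let ?xs = "sorted_key_list_of_set Min (blocks n S)"
  have xs: "set ?xs = blocks n S" "length ?xs = num_blocks n S"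
    using sorted_key_list_of_set_enumerates[OF fin inj] by (simp_all add: num_blocks_def)
  have "block n S ` {1..num_blocks n S} = (!) ?xs ` ((\<lambda>j. j - 1) ` {1..length ?xs})"
    by (simp add: block_def image_image xs(2))
  also have "(\<lambda>j. j - 1) ` {1..length ?xs} = {..<length ?xs}"
    by (auto simp: image_iff intro!: bexI[of _ "Suc _"])
  also have "(!) ?xs ` {..<length ?xs} = set ?xs" by (auto simp: set_conv_nth)
  finally show ?thesis by (simp only: xs)
qed

lemma block_stable:
  assumes \<tau>: "\<tau> \<in> S" and I: "{a..<k} \<in> blocks n S" "1 \<le> a" "a < k" "k \<le> Suc n"
  shows "\<tau> ` {1..<a} = {1..<a}" "\<tau> ` {a..<k} = {a..<k}"
proof -
  have inv: "\<tau> ` J = J" if "J \<in> blocks n S" for J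
    using blocks_invariant[OF that] \<tau> by (simp add: invariant_interval_def)
  show "\<tau> ` {a..<k} = {a..<k}" by (rule inv[OF I(1)])
  have "\<tau> ` {1..<a} \<subseteq> {1..<a}"
  proof (rule image_subsetI)
    fix x assume x: "x \<in> {1..<a}"
    then obtain J where J: "J \<in> blocks n S" "x \<in> J" using block_ex[of x] I by auto
    obtain c d where cd: "J = {c..<d}" "1 \<le> c" using block_obtain_bounds[OF J(1)] by metis
    have "a \<notin> J"
      using block_unique[OF I(1) J(1), of a] J(2) x I by auto
    then have "J \<subseteq> {1..<a}" using J(2) x cd by auto
    then show "\<tau> x \<in> {1..<a}" using inv[OF J(1)] J(2) by blast
  qed
  moreover have "inj_on \<tau> {1..<a}"
    using S \<tau> permutes_inj inj_on_subset by blast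
  ultimately show "\<tau> ` {1..<a} = {1..<a}"
    by (intro card_subset_eq) (auto simp: card_image)
qed

definition label :: "nat \<Rightarrow> nat set" where
  "label x = (THE I. I \<in> blocks n S \<and> x \<in> I)"

lemma label_eq: "I \<in> blocks n S \<Longrightarrow> x \<in> I \<Longrightarrow> label x = I"
  unfolding label_def by (rule the_equality) (simp, metis block_unique)

lemma label_block: "x \<in> {1..n} \<Longrightarrow> label x \<in> blocks n S \<and> x \<in> label x"
  using block_ex label_eq by metis

sublocale interval_labelling n label
proof
  fix x y z assume xyz: "1 \<le> x" "x \<le> y" "y \<le> z" "z \<le> n" "label x = label z"
  then have "x \<in> label z" "z \<in> label z" "label z \<in> blocks n S"
    using label_block[of x] label_block[of z] by auto
  then have "y \<in> label z"
    using xyz block_obtain_bounds[of "label z"] by (metis atLeastLessThan_iff le_trans le_less_trans)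
  then show "label y = label z" using label_eq \<open>label z \<in> blocks n S\<close> by blast
qed

lemma fiber_label: "I \<in> blocks n S \<Longrightarrow> fiber I = I"
  using blocks_partition label_block label_eq unfolding fiber_def partition_on_def by blast

text \<open>
  If all permutations in \<open>S\<close> preserved \<open>{1..i}\<close>, cutting \<open>{1..n}\<close> after \<open>i\<close> would give an invariant
  partition, which the finest one would have to refine.
\<close>

lemma separating_permutation:
  assumes "1 \<le> i" "i < n" "label i = label (Suc i)"
  obtains \<tau> where "\<tau> \<in> S" "\<tau> ` {1..i} \<noteq> {1..i}"
proof (rule ccontr)
  assume "\<not> thesis"
  with that have missed: "\<not> (\<tau> \<in> S \<and> \<tau> ` {1..i} \<noteq> {1..i})" for \<tau> by blast
  have stable: "\<tau> ` {1..i} = {1..i}" if "\<tau> \<in> S" for \<tau>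
    using missed that by blast
  let ?P = "{{1..i}, {Suc i..n}}"
  have "\<tau> ` {Suc i..n} = {Suc i..n}" if "\<tau> \<in> S" for \<tau>
  proof -
    have "\<tau> permutes {1..n}" using S that by blast
    moreover have "{Suc i..n} = {1..n} - {1..i}" using assms by auto
    ultimately show ?thesis
      using stable[OF that] permutes_image[of \<tau> "{1..n}"] permutes_inj[of \<tau> "{1..n}"] by (simp add: image_set_diff)
  qed
  then have "invariant_interval_partition n S ?P"
    using assms stable
    by (auto simp: invariant_interval_partition_def invariant_interval_def partition_on_def disjoint_def)
  then have "refines {1..n} (blocks n S) ?P" by (rule blocks_finest)
  moreover have "label i \<in> blocks n S" "i \<in> label i" "Suc i \<in> label i"
    using assms label_block[of i] label_block[of "Suc i"] by auto
  ultimately show False unfolding refines_def by fastforce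
qed

lemma Lambda_generators:
  "{Lambda n m (block n S j) | j m. j \<in> {1..num_blocks n S} \<and> m \<in> {1..card (block n S j)}} =
   {Lambda n m I | I m. I \<in> blocks n S \<and> m \<in> {1..card I}}"
  unfolding block_image[symmetric] by blast

lemma Qact_Lambda:
  assumes "\<tau> \<in> S" "I \<in> blocks n S"
  shows "Qact \<tau> (Lambda n m I) = (Lambda n m I :: 'k::field freealg set)"
proof -
  have \<tau>: "\<tau> permutes {1..n}" using S assms by blast
  obtain a k where ak: "I = {a..<k}" "1 \<le> a" "a < k" "k \<le> Suc n" by (rule block_obtain_bounds[OF assms(2)])
  show ?thesis
    using Lambda_invariant(1)[OF \<tau> ak(2) less_imp_le[OF ak(3)] ak(4)] block_stable[OF assms(1), of a k] assms(2) ak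
    by simp
qed

lemma Lambda_block_in_Qsub:
  assumes "\<tau> \<in> S" "I \<in> blocks n S"
  shows "Lambda n m I \<in> (Qsub n \<tau> :: 'k::field freealg set set)"
proof -
  have \<tau>: "\<tau> permutes {1..n}" using S assms by blast
  obtain a k where ak: "I = {a..<k}" "1 \<le> a" "a < k" "k \<le> Suc n" by (rule block_obtain_bounds[OF assms(2)])
  show ?thesis
    using Lambda_in_Qsub[OF \<tau> ak(2) less_imp_le[OF ak(3)] ak(4)] block_stable[OF assms(1), of a k] assms(2) ak
    by simp
qed

lemma Inter_subset:
  assumes "id \<in> S"
  shows "(\<Inter>\<tau>\<in>S. Qsub n \<tau> :: 'k::field freealg set set) \<subseteq>
    Qgenerated n {Lambda n m I | I m. I \<in> blocks n S \<and> m \<in> {1..card I}}" (is "_ \<subseteq> Qgenerated n ?L")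
proof
  fix f :: "'k freealg set" assume f: "f \<in> (\<Inter>\<tau>\<in>S. Qsub n \<tau>)"
  obtain F where F: "F \<in> polys_on {1..n}" "f = Qproj n (fsubst (flag_gen id) F)"
    using Qsub_obtain_poly[OF permutes_id, of f n] f assms by blast
  have inv: "move_invariant (\<lambda>w. Poly_Mapping.lookup F (FMon w))"
    unfolding move_invariant_def
  proof (intro allI impI, elim conjE)
    fix i u v assume i: "1 \<le> i" "i < n" "label i = label (Suc i)"
      and uv: "u = [] \<or> last u \<noteq> Suc i" "v = [] \<or> hd v \<noteq> i"
    obtain \<tau> where \<tau>: "\<tau> \<in> S" "\<tau> ` {1..i} \<noteq> {1..i}" using separating_permutation[OF i] by blast
    then have perm: "\<tau> permutes {1..n}" using S by blast
    obtain G where G: "G \<in> polys_on {1..n}" "f = Qproj n (fsubst (flag_gen \<tau>) G)"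
      using Qsub_obtain_poly[OF perm, of f] f \<tau>(1) by blast
    have "fsubst (twist i i) F = fsubst (twist i (Suc i)) F"
      by (rule twist_eq_if_missed[OF perm F(1) G(1) _ \<tau>(2)]) (use F(2) G(2) in simp)
    then show "Poly_Mapping.lookup F (FMon (u @ i # v)) = Poly_Mapping.lookup F (FMon (u @ Suc i # v))"
      by (rule lookup_eq_if_fsubst_twist_eq[OF _ uv])
  qed
  show "f \<in> Qgenerated n ?L"
  proof (rule Qgenerated_I)
    fix B :: "'k freealg set set"
    assume B: "Qsubalgebra n B" and L: "?L \<subseteq> B"
    define C where "C = {p \<in> carrier (free_alg n). Qproj n p \<in> B}"
    have C: "free_subalgebra n C" unfolding C_def by (rule Qsubalgebra_preimage[OF B])
    have flag_sub: "free_subalgebra n (fsubst (flag_gen id) ` (polys_on {1..n} :: (nat fmon \<Rightarrow>\<^sub>0 'k) set))"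
      by (rule free_subalgebra_fsubst) (rule flag_gen_in_free_alg[OF permutes_id])
    have "F \<in> {P. fsubst (flag_gen id) P \<in> C}"
    proof (rule move_invariant_in_closed[OF _ _ _ _ _ _ inv])
      fix J m assume J: "J \<in> label ` {1..n}" and m: "0 < (m::nat)"
      then have JB: "J \<in> blocks n S" using label_block by blast
      then have sub: "J \<subseteq> {1..n}" using blocks_partition by (auto simp: partition_on_def)
      have fin: "finite J" using sub finite_subset by blast
      have "fsubst (flag_gen id) (elem_sym m J) \<in> C"
      proof (cases "m \<le> card J")
        case True
        then have "Lambda n m J \<in> B" using L JB m by (auto simp: Suc_le_eq)
        moreover have "elem_sym m J \<in> (polys_on {1..n} :: (nat fmon \<Rightarrow>\<^sub>0 'k) set)"
        proof -
          have "Poly_Mapping.keys (elem_sym m J :: nat fmon \<Rightarrow>\<^sub>0 'k) \<subseteq> FMon ` decreasing_lists m J"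
            unfolding elem_sym_def by (rule order_trans[OF keys_sum]) (auto simp: word_def)
          then show ?thesis using sub by (fastforce simp: polys_on_def decreasing_lists_def)
        qed
        then have "fsubst (flag_gen id) (elem_sym m J) \<in> carrier (free_alg n :: 'k freealg ring)"
          using flag_sub unfolding free_subalgebra_def by blast
        ultimately show ?thesis unfolding C_def Lambda_eq_Qproj[OF sub] by blast
      next
        case False
        \<comment> \<open>Beyond the size of the block the elementary function vanishes.\<close>
        have "decreasing_lists m J = {}"
        proof -
          have "length xs \<le> card J" if "sorted_wrt (>) xs" "set xs \<subseteq> J" for xs
          proof -
            have "distinct xs" using that(1) by (induction xs) auto
            then show ?thesis using card_mono[OF fin that(2)] distinct_card by metis
          qed
          then show ?thesis using False by (auto simp: decreasing_lists_def)
        qed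
        then show ?thesis using free_subalgebra_closed(2)[OF C] by (simp add: elem_sym_def)
      qed
      then show "elem_sym m (fiber J) \<in> {P. fsubst (flag_gen id) P \<in> C}" by (simp add: fiber_label[OF JB])
    qed (use F(1) in \<open>auto simp: fsubst_add fsubst_mult fsubst_scalar polys_on_def free_subalgebra_closed[OF C]\<close>)
    then show "f \<in> B" using F(2) by (simp add: C_def)
  qed
qed

end

theorem theorem1p5p5:
  fixes n :: nat
    and S :: "(nat \<Rightarrow> nat) set"
  assumes "n \<ge> 1"
    and "S \<subseteq> {\<sigma>. \<sigma> permutes {1..n}}"
  shows "(\<forall>\<tau>\<in>S. \<forall>j\<in>{1..num_blocks n S}. \<forall>m\<le>card (block n S j).
            Qact \<tau> (Lambda n m (block n S j) :: 'k::field freealg set) = Lambda n m (block n S j))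
       \<and> (id \<in> S \<longrightarrow>
            (\<Inter>\<tau>\<in>S. Qsub n \<tau> :: 'k freealg set set) =
              Qgenerated n {Lambda n m (block n S j) | j m.
                j \<in> {1..num_blocks n S} \<and> m \<in> {1..card (block n S j)}})"
proof -
  interpret permutation_set n S by unfold_locales (use assms in auto)
  show ?thesis
  proof (intro conjI ballI allI impI)
    fix \<tau> j m assume "\<tau> \<in> S" "j \<in> {1..num_blocks n S}"
    then show "Qact \<tau> (Lambda n m (block n S j)) = (Lambda n m (block n S j) :: 'k freealg set)"
      using block_image by (intro Qact_Lambda) auto
  next
    assume "id \<in> S"
    show "(\<Inter>\<tau>\<in>S. Qsub n \<tau> :: 'k freealg set set) =
        Qgenerated n {Lambda n m (block n S j) | j m. j \<in> {1..num_blocks n S} \<and> m \<in> {1..card (block n S j)}}"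
      unfolding Lambda_generators
    proof (rule subset_antisym[OF Inter_subset[OF \<open>id \<in> S\<close>]], rule INT_greatest)
      fix \<tau> assume "\<tau> \<in> S"
      then have "{Lambda n m I | I m. I \<in> blocks n S \<and> m \<in> {1..card I}} \<subseteq> (Qsub n \<tau> :: 'k freealg set set)"
        using Lambda_block_in_Qsub by blast
      then show "Qgenerated n {Lambda n m I | I m. I \<in> blocks n S \<and> m \<in> {1..card I}} \<subseteq> (Qsub n \<tau> :: 'k freealg set set)"
        unfolding Qsub_def by (rule Qgenerated_subset)
    qed
  qed
qed

end
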